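(* Consider the boundary-controlled port-Hamiltonian system (BC-PHS) and its finite-dimensional discretized model $\Sigma_d$ described in the context. The discretized model $$\Sigma_d:\quad E\dot{x}_d=(J-R)e_d+Bu,\qquad E e_d=Q x_d,\qquad y=B^\top e_d$$ is passive with respect to the storage energy function $$H_d(t)=\tfrac12 x_d(t)^\top E e_d(t)=\tfrac12 x_d(t)^\top Q x_d(t).$$ Moreover, if the BC-PHS is impedance energy preserving (IEP), then the discretized model $\Sigma_d$ is IEP (with the same function $H_d$).
   Context: **The PDE.** Let $a<b$, $n=n_1+n_2$ with $n_1,n_2\ge 1$. Let $P,G\in\mathbb{R}^{n\times n}$ be constant matrices, $P=P^\top$ invertible and $G+G^\top\ge 0$ (positive semi-definite). Let $\mathcal{H}:[a,b]\to\mathbb{R}^{n\times n}$ be bounded, continuously differentiable, symmetric, and positive definite at every $\zeta\in[a,b]$. In blocks, $$P=\begin{pmatrix}P_{11}&P_{12}\\ P_{21}&P_{22}\end{pmatrix},\quad G=\begin{pmatrix}G_{11}&G_{12}\\ G_{21}&G_{22}\end{pmatrix},\quad \mathcal{H}(\zeta)=\begin{pmatrix}\mathcal{H}_1(\zeta)&0\\ 0&\mathcal{H}_2(\zeta)\end{pmatrix},$$ where $P_{ij},G_{ij}\in\mathbb{R}^{n_i\times n_j}$, $\mathcal{H}_i(\zeta)\in\mathbb{R}^{n_i\times n_i}$. The PDE is $$\frac{\partial x}{\partial t}(\zeta,t)=P\frac{\partial e}{\partial \zeta}(\zeta,t)-G\,e(\zeta,t),\qquad e(\zeta,t)=\mathcal{H}(\zeta)x(\zeta,t),\qquad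 x(\zeta,0)=x_0(\zeta),$$ with $x(\zeta,t),e(\zeta,t)\in\mathbb{R}^n$, $\zeta\in[a,b]$, $t\ge0$. **Boundary input and output.** $V_{\mathcal{B}},V_{\mathcal{C}}\in\mathbb{R}^{n\times 2n}$ are full-rank matrices with $$V_i\begin{pmatrix}P^{-1}&0\\ 0&-P^{-1}\end{pmatrix}V_i^\top=0_n,\quad i\in\{\mathcal{B},\mathcal{C}\},\qquad\text{and}\qquad V_{\mathcal{C}}^\top V_{\mathcal{B}}+V_{\mathcal{B}}^\top V_{\mathcal{C}}=\begin{pmatrix}P&0\\ 0&-P\end{pmatrix};$$ the last identity says that $V_{\mathcal{C}}^\top V_{\mathcal{B}}=\frac12\begin{pmatrix}P&0\\ 0&-P\end{pmatrix}-\tilde J_\xi$ for some skew-symmetric $\tilde J_\xi\in\mathbb{R}^{2n\times 2n}$. The input and output are $$u(t)=V_{\mathcal{B}}\begin{pmatrix}e(b,t)\\ e(a,t)\end{pmatrix},\qquad y(t)=V_{\mathcal{C}}\begin{pmatrix}e(b,t)\\ e(a,t)\end{pmatrix}.$$ The PDE together with this input and output is called the BC-PHS. Its Hamiltonian is $H(t)=\frac12\int_a^b x(\zeta,t)^\top\mathcal{H}(\zeta)x(\zeta,t)\,d\zeta$. A solution of the BC-PHS is understood as $x\in C^1([0,\infty);L^2((a,b);\mathbb{R}^n))$ with $e=\mathcal{H}x\in C([0,\infty);H^1((a,b);\mathbb{R}^n))$ satisfying the PDE. **Discretization.** For $i\in\{1,2\}$ let $\phi_i=(\phi_i^1,\dots,\phi_i^{N_i})^\top$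 be a column vector of linearly independent scalar functions in $H^1(a,b)$, and let $\Phi_i(\zeta)\in\mathbb{R}^{n_iN_i\times n_i}$ be the block-diagonal matrix with $n_i$ diagonal blocks all equal to $\phi_i(\zeta)$. Set, for $i,j\in\{1,2\}$, $$E_i=\int_a^b\Phi_i\Phi_i^\top d\zeta,\quad Q_i=\int_a^b\Phi_i\mathcal{H}_i\Phi_i^\top d\zeta,\quad D^P_{ij}=\int_a^b\Phi_iP_{ij}(\partial_\zeta\Phi_j)^\top d\zeta,\quad D^G_{ij}=\int_a^b\Phi_iG_{ij}\Phi_j^\top d\zeta,$$ $$E=\begin{pmatrix}E_1&0\\ 0&E_2\end{pmatrix},\quad Q=\begin{pmatrix}Q_1&0\\ 0&Q_2\end{pmatrix},\quad D^P=\begin{pmatrix}D^P_{11}&D^P_{12}\\ D^P_{21}&D^P_{22}\end{pmatrix},\quad D^G=\begin{pmatrix}D^G_{11}&D^G_{12}\\ D^G_{21}&D^G_{22}\end{pmatrix},$$ $$\Omega_{ba}=\begin{pmatrix}\Phi_1(b)&0&\Phi_1(a)&0\\ 0&\Phi_2(b)&0&\Phi_2(a)\end{pmatrix}\in\mathbb{R}^{(n_1N_1+n_2N_2)\times 2n},$$ $$B=\Omega_{ba}V_{\mathcal{C}}^\top,\qquad J=D^P-\tfrac12\big(D^G-(D^G)^\top\big)-\Omega_{ba}V_{\mathcal{C}}^\top V_{\mathcal{B}}\Omega_{ba}^\top,\qquad R=\tfrac12\big(D^G+(D^G)^\top\big).$$ The mass matrix $E$ is symmetric positive definite. The model $\Sigma_d$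 has state $x_d(t)\in\mathbb{R}^{n_1N_1+n_2N_2}$, initial condition $x_d(0)=x_{d0}$, input $u(t)\in\mathbb{R}^n$ and output $y(t)\in\mathbb{R}^n$. **Passivity and IEP.** A state space system with state space $X$, input $u$ and output $y$ is called passive if there is a storage function $S:X\to\mathbb{R}_+$ such that for all initial conditions in $X$, all input functions $u$ and all $t\ge0$, one has $\dot S(t)\le u(t)^\top y(t)$ along the corresponding trajectory; it is called impedance energy preserving (IEP) if $\dot S(t)=u(t)^\top y(t)$ in the same sense. Inputs are taken in $L^2_{loc}((0,\infty),\mathbb{R}^n)$, and for non-continuous inputs the (in)equality for $\Sigma_d$ is understood for almost every $t$. For the BC-PHS, passivity and IEP are understood with the Hamiltonian $H$ as storage function, so "the BC-PHS is IEP" means $\dot H(t)=u(t)^\top y(t)$ for all $t\geq 0$ along every solution. *)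

theory Defs
  imports "HOL-Analysis.Analysis"
begin

text \<open>
  Direct sums of coordinate spaces are indexed by sum types, so that the dimensions
  \<open>n\<^sub>1\<close>, \<open>n\<^sub>2\<close>, \<open>n = n\<^sub>1 + n\<^sub>2\<close>, \<open>2 n\<close> are the cardinalities of
  \<open>'n1\<close>, \<open>'n2\<close>, \<open>'n1 + 'n2\<close>, \<open>('n1 + 'n2) + ('n1 + 'n2)\<close>.
\<close>

definition vcat :: "real ^ 'c \<Rightarrow> real ^ 'd \<Rightarrow> real ^ ('c::finite + 'd::finite)" where
  "vcat v w = (\<chi> i. case i of Inl c \<Rightarrow> v $ c | Inr d \<Rightarrow> w $ d)"

definition hcat :: "real ^ 'c ^ 'r \<Rightarrow> real ^ 'd ^ 'r \<Rightarrow> real ^ ('c::finite + 'd::finite) ^ 'r::finite" where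
  "hcat A B = (\<chi> r. vcat (A $ r) (B $ r))"

definition block_mat ::
  "real ^ 'c ^ 'r \<Rightarrow> real ^ 'd ^ 'r \<Rightarrow> real ^ 'c ^ 's \<Rightarrow> real ^ 'd ^ 's
    \<Rightarrow> real ^ ('c::finite + 'd::finite) ^ ('r::finite + 's::finite)" where
  "block_mat A B C D = (\<chi> i. case i of Inl r \<Rightarrow> vcat (A $ r) (B $ r) | Inr s \<Rightarrow> vcat (C $ s) (D $ s))"

definition blk11 :: "real ^ ('c::finite + 'd::finite) ^ ('r::finite + 's::finite) \<Rightarrow> real ^ 'c ^ 'r" where
  "blk11 A = (\<chi> i j. A $ Inl i $ Inl j)"
definition blk12 :: "real ^ ('c::finite + 'd::finite) ^ ('r::finite + 's::finite) \<Rightarrow> real ^ 'd ^ 'r" where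
  "blk12 A = (\<chi> i j. A $ Inl i $ Inr j)"
definition blk21 :: "real ^ ('c::finite + 'd::finite) ^ ('r::finite + 's::finite) \<Rightarrow> real ^ 'c ^ 's" where
  "blk21 A = (\<chi> i j. A $ Inr i $ Inl j)"
definition blk22 :: "real ^ ('c::finite + 'd::finite) ^ ('r::finite + 's::finite) \<Rightarrow> real ^ 'd ^ 's" where
  "blk22 A = (\<chi> i j. A $ Inr i $ Inr j)"

definition symmetric_mat :: "real ^ 'k ^ 'k::finite \<Rightarrow> bool" where
  "symmetric_mat A \<longleftrightarrow> transpose A = A"

definition pos_semidef_mat :: "real ^ 'k ^ 'k::finite \<Rightarrow> bool" where
  "pos_semidef_mat A \<longleftrightarrow> symmetric_mat A \<and> (\<forall>v. 0 \<le> v \<bullet> (A *v v))"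

definition pos_def_mat :: "real ^ 'k ^ 'k::finite \<Rightarrow> bool" where
  "pos_def_mat A \<longleftrightarrow> symmetric_mat A \<and> (\<forall>v. v \<noteq> 0 \<longrightarrow> 0 < v \<bullet> (A *v v))"

definition C1_on_interval :: "real \<Rightarrow> real \<Rightarrow> (real \<Rightarrow> 'v::real_normed_vector) \<Rightarrow> bool" where
  "C1_on_interval a b f \<longleftrightarrow>
     (\<exists>f'. continuous_on {a..b} f' \<and>
       (\<forall>z\<in>{a..b}. (f has_vector_derivative f' z) (at z within {a..b})))"

definition L2_fun :: "real \<Rightarrow> real \<Rightarrow> (real \<Rightarrow> 'v::euclidean_space) \<Rightarrow> bool" where
  "L2_fun a b f \<longleftrightarrow> f \<in> borel_measurable (lebesgue_on {a..b}) \<and>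
     integrable (lebesgue_on {a..b}) (\<lambda>z. (norm (f z))\<^sup>2)"

definition L2_norm :: "real \<Rightarrow> real \<Rightarrow> (real \<Rightarrow> 'v::euclidean_space) \<Rightarrow> real" where
  "L2_norm a b f = sqrt (LINT z|lebesgue_on {a..b}. (norm (f z))\<^sup>2)"

text \<open>
  \<open>f\<close> is absolutely continuous on \<open>[a,b]\<close> with a.e. derivative \<open>f'\<close>: it is a.e. differentiable,
  its derivative is integrable, and the fundamental theorem of calculus holds.
\<close>

definition has_ac_derivative ::
  "real \<Rightarrow> real \<Rightarrow> (real \<Rightarrow> 'v::euclidean_space) \<Rightarrow> (real \<Rightarrow> 'v) \<Rightarrow> bool" where
  "has_ac_derivative a b f f' \<longleftrightarrow>
     integrable (lebesgue_on {a..b}) f' \<and>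
     (AE z in lebesgue_on {a..b}. (f has_vector_derivative f' z) (at z within {a..b})) \<and>
     (\<forall>z\<in>{a..b}. f z = f a + (LINT s|lebesgue_on {a..z}. f' s))"

text \<open>
  \<open>f \<in> H\<^sup>1(a,b)\<close> with derivative \<open>f'\<close>; \<open>f\<close> is the absolutely continuous representative on
  \<open>[a,b]\<close>, so that \<open>f a\<close> and \<open>f b\<close> are the boundary traces, while \<open>f'\<close> is any representative
  of its \<open>L\<^sup>2\<close> derivative.
\<close>

definition has_H1_derivative ::
  "real \<Rightarrow> real \<Rightarrow> (real \<Rightarrow> 'v::euclidean_space) \<Rightarrow> (real \<Rightarrow> 'v) \<Rightarrow> bool" where
  "has_H1_derivative a b f f' \<longleftrightarrow> has_ac_derivative a b f f' \<and> L2_fun a b f \<and> L2_fun a b f'"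

text \<open>Curves \<open>[0,\<infinity>) \<rightarrow> L\<^sup>2((a,b))\<close>; the first argument of a curve is time.\<close>

definition L2_continuous :: "real \<Rightarrow> real \<Rightarrow> (real \<Rightarrow> real \<Rightarrow> 'v::euclidean_space) \<Rightarrow> bool" where
  "L2_continuous a b f \<longleftrightarrow>
     (\<forall>t\<ge>0. L2_fun a b (f t)) \<and>
     (\<forall>t\<ge>0. ((\<lambda>s. L2_norm a b (\<lambda>z. f s z - f t z)) \<longlongrightarrow> 0) (at t within {0..}))"

definition L2_has_C1_derivative ::
  "real \<Rightarrow> real \<Rightarrow> (real \<Rightarrow> real \<Rightarrow> 'v::euclidean_space) \<Rightarrow> (real \<Rightarrow> real \<Rightarrow> 'v) \<Rightarrow> bool" where
  "L2_has_C1_derivative a b f f' \<longleftrightarrow>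
     (\<forall>t\<ge>0. L2_fun a b (f t)) \<and> L2_continuous a b f' \<and>
     (\<forall>t\<ge>0. ((\<lambda>s. L2_norm a b (\<lambda>z. (f s z - f t z) /\<^sub>R (s - t) - f' t z)) \<longlongrightarrow> 0)
               (at t within {0..}))"

text \<open>
  \<open>x \<in> C\<^sup>1([0,\<infinity>); L\<^sup>2)\<close> with \<open>e = \<H> x \<in> C([0,\<infinity>); H\<^sup>1)\<close>; \<open>e t\<close> is the absolutely continuous
  representative of \<open>\<H> x(t)\<close>, hence the equalities hold almost everywhere in space.
\<close>

definition bcphs_solution ::
  "real \<Rightarrow> real \<Rightarrow> real ^ 'n ^ 'n \<Rightarrow> real ^ 'n ^ 'n \<Rightarrow> (real \<Rightarrow> real ^ 'n ^ 'n)
    \<Rightarrow> (real \<Rightarrow> real \<Rightarrow> real ^ 'n) \<Rightarrow> (real \<Rightarrow> real \<Rightarrow> real ^ 'n::finite) \<Rightarrow> bool" where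
  "bcphs_solution a b P G H x e \<longleftrightarrow>
     (\<exists>dtx dze.
        L2_has_C1_derivative a b x dtx \<and>
        (\<forall>t\<ge>0. has_H1_derivative a b (e t) (dze t)) \<and>
        L2_continuous a b e \<and> L2_continuous a b dze \<and>
        (\<forall>t\<ge>0. AE z in lebesgue_on {a..b}. e t z = H z *v x t z) \<and>
        (\<forall>t\<ge>0. AE z in lebesgue_on {a..b}. dtx t z = P *v dze t z - G *v e t z))"

definition bcphs_port ::
  "real \<Rightarrow> real \<Rightarrow> real ^ ('n + 'n) ^ 'n \<Rightarrow> (real \<Rightarrow> real \<Rightarrow> real ^ 'n) \<Rightarrow> real \<Rightarrow> real ^ 'n::finite" where
  "bcphs_port a b V e t = V *v vcat (e t b) (e t a)"

definition hamiltonian ::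
  "real \<Rightarrow> real \<Rightarrow> (real \<Rightarrow> real ^ 'n ^ 'n) \<Rightarrow> (real \<Rightarrow> real ^ 'n::finite) \<Rightarrow> real" where
  "hamiltonian a b H x = 1/2 * (LINT z|lebesgue_on {a..b}. x z \<bullet> (H z *v x z))"

definition bcphs_IEP ::
  "real \<Rightarrow> real \<Rightarrow> real ^ 'n ^ 'n \<Rightarrow> real ^ 'n ^ 'n \<Rightarrow> (real \<Rightarrow> real ^ 'n ^ 'n)
    \<Rightarrow> real ^ ('n + 'n) ^ 'n \<Rightarrow> real ^ ('n + 'n) ^ 'n::finite \<Rightarrow> bool" where
  "bcphs_IEP a b P G H VB VC \<longleftrightarrow>
     (\<forall>x e. bcphs_solution a b P G H x e \<longrightarrow>
       (\<forall>t\<ge>0. ((\<lambda>s. hamiltonian a b H (x s)) has_real_derivative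
                 bcphs_port a b VB e t \<bullet> bcphs_port a b VC e t) (at t within {0..})))"

text \<open>
  A state space system is given by its set of trajectories \<open>(u, x, y)\<close> (input, state, output) on
  \<open>[0,\<infinity>)\<close>.  The power balance is required for almost every \<open>t\<close>, and for every \<open>t \<ge> 0\<close> if the
  input is continuous.
\<close>

type_synonym ('x, 'u) system = "(real \<Rightarrow> 'u) \<Rightarrow> (real \<Rightarrow> 'x) \<Rightarrow> (real \<Rightarrow> 'u) \<Rightarrow> bool"

definition passive_wrt :: "('x, 'u::euclidean_space) system \<Rightarrow> ('x \<Rightarrow> real) \<Rightarrow> bool" where
  "passive_wrt \<Sigma> S \<longleftrightarrow>
     (\<forall>z. 0 \<le> S z) \<and>
     (\<forall>u x y. \<Sigma> u x y \<longrightarrow>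
       (AE t in lebesgue_on {0..}. \<exists>d. ((\<lambda>s. S (x s)) has_real_derivative d) (at t within {0..})
                                        \<and> d \<le> u t \<bullet> y t) \<and>
       (continuous_on {0..} u \<longrightarrow>
         (\<forall>t\<ge>0. \<exists>d. ((\<lambda>s. S (x s)) has_real_derivative d) (at t within {0..}) \<and> d \<le> u t \<bullet> y t)))"

definition IEP_wrt :: "('x, 'u::euclidean_space) system \<Rightarrow> ('x \<Rightarrow> real) \<Rightarrow> bool" where
  "IEP_wrt \<Sigma> S \<longleftrightarrow>
     (\<forall>z. 0 \<le> S z) \<and>
     (\<forall>u x y. \<Sigma> u x y \<longrightarrow>
       (AE t in lebesgue_on {0..}. ((\<lambda>s. S (x s)) has_real_derivative u t \<bullet> y t) (at t within {0..})) \<and>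
       (continuous_on {0..} u \<longrightarrow>
         (\<forall>t\<ge>0. ((\<lambda>s. S (x s)) has_real_derivative u t \<bullet> y t) (at t within {0..}))))"

text \<open>
  The block-diagonal matrix with \<open>n\<^sub>i\<close> diagonal blocks equal to the column \<open>\<phi>\<^sub>i(\<zeta>)\<close>: row
  \<open>(k, l)\<close> is the \<open>l\<close>-th row of the \<open>k\<close>-th block.  Applied to \<open>\<phi>\<^sub>i'(\<zeta>)\<close> it gives
  \<open>\<partial>\<^sub>\<zeta>\<Phi>\<^sub>i(\<zeta>)\<close>.
\<close>

definition Phi :: "real ^ 'N \<Rightarrow> real ^ 'n ^ ('n::finite \<times> 'N::finite)" where
  "Phi v = (\<chi> p j. if j = fst p then v $ snd p else 0)"

context
  fixes a b :: real
begin

definition E_mat ::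
  "(real \<Rightarrow> real ^ 'N1) \<Rightarrow> (real \<Rightarrow> real ^ 'N2)
    \<Rightarrow> real ^ (('n1::finite \<times> 'N1::finite) + ('n2::finite \<times> 'N2::finite)) ^ (('n1 \<times> 'N1) + ('n2 \<times> 'N2))" where
  "E_mat \<phi>1 \<phi>2 = block_mat
     (LINT z|lebesgue_on {a..b}. (Phi (\<phi>1 z) :: real ^ 'n1 ^ ('n1 \<times> 'N1)) ** transpose (Phi (\<phi>1 z))) 0
     0 (LINT z|lebesgue_on {a..b}. (Phi (\<phi>2 z) :: real ^ 'n2 ^ ('n2 \<times> 'N2)) ** transpose (Phi (\<phi>2 z)))"

definition Q_mat ::
  "(real \<Rightarrow> real ^ ('n1 + 'n2) ^ ('n1 + 'n2)) \<Rightarrow> (real \<Rightarrow> real ^ 'N1) \<Rightarrow> (real \<Rightarrow> real ^ 'N2)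
    \<Rightarrow> real ^ (('n1::finite \<times> 'N1::finite) + ('n2::finite \<times> 'N2::finite)) ^ (('n1 \<times> 'N1) + ('n2 \<times> 'N2))" where
  "Q_mat H \<phi>1 \<phi>2 = block_mat
     (LINT z|lebesgue_on {a..b}. Phi (\<phi>1 z) ** blk11 (H z) ** transpose (Phi (\<phi>1 z))) 0
     0 (LINT z|lebesgue_on {a..b}. Phi (\<phi>2 z) ** blk22 (H z) ** transpose (Phi (\<phi>2 z)))"

text \<open>
  The matrix with blocks \<open>\<integral> \<Phi>\<^sub>i M\<^sub>i\<^sub>j \<Psi>\<^sub>j\<^sup>T\<close>, where \<open>\<Psi>\<^sub>j\<close> is built from \<open>\<psi>\<^sub>j\<close>:  \<open>D\<^sup>P\<close> is obtained
  for \<open>M = P\<close> and \<open>\<psi>\<^sub>j = \<phi>\<^sub>j'\<close>, and \<open>D\<^sup>G\<close> for \<open>M = G\<close> and \<open>\<psi>\<^sub>j = \<phi>\<^sub>j\<close>.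
\<close>

definition D_mat ::
  "real ^ ('n1 + 'n2) ^ ('n1 + 'n2) \<Rightarrow> (real \<Rightarrow> real ^ 'N1) \<Rightarrow> (real \<Rightarrow> real ^ 'N2)
    \<Rightarrow> (real \<Rightarrow> real ^ 'N1) \<Rightarrow> (real \<Rightarrow> real ^ 'N2)
    \<Rightarrow> real ^ (('n1::finite \<times> 'N1::finite) + ('n2::finite \<times> 'N2::finite)) ^ (('n1 \<times> 'N1) + ('n2 \<times> 'N2))" where
  "D_mat M \<phi>1 \<phi>2 \<psi>1 \<psi>2 = block_mat
     (LINT z|lebesgue_on {a..b}. Phi (\<phi>1 z) ** blk11 M ** transpose (Phi (\<psi>1 z)))
     (LINT z|lebesgue_on {a..b}. Phi (\<phi>1 z) ** blk12 M ** transpose (Phi (\<psi>2 z)))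
     (LINT z|lebesgue_on {a..b}. Phi (\<phi>2 z) ** blk21 M ** transpose (Phi (\<psi>1 z)))
     (LINT z|lebesgue_on {a..b}. Phi (\<phi>2 z) ** blk22 M ** transpose (Phi (\<psi>2 z)))"

definition Omega_ba ::
  "(real \<Rightarrow> real ^ 'N1) \<Rightarrow> (real \<Rightarrow> real ^ 'N2)
    \<Rightarrow> real ^ (('n1 + 'n2) + ('n1 + 'n2)) ^ (('n1::finite \<times> 'N1::finite) + ('n2::finite \<times> 'N2::finite))" where
  "Omega_ba \<phi>1 \<phi>2 =
     hcat (block_mat (Phi (\<phi>1 b)) 0 0 (Phi (\<phi>2 b))) (block_mat (Phi (\<phi>1 a)) 0 0 (Phi (\<phi>2 a)))"

definition B_mat ::
  "real ^ (('n1 + 'n2) + ('n1 + 'n2)) ^ ('n1 + 'n2) \<Rightarrow> (real \<Rightarrow> real ^ 'N1) \<Rightarrow> (real \<Rightarrow> real ^ 'N2)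
    \<Rightarrow> real ^ ('n1 + 'n2) ^ (('n1::finite \<times> 'N1::finite) + ('n2::finite \<times> 'N2::finite))" where
  "B_mat VC \<phi>1 \<phi>2 = Omega_ba \<phi>1 \<phi>2 ** transpose VC"

definition J_mat ::
  "real ^ ('n1 + 'n2) ^ ('n1 + 'n2) \<Rightarrow> real ^ ('n1 + 'n2) ^ ('n1 + 'n2)
    \<Rightarrow> real ^ (('n1 + 'n2) + ('n1 + 'n2)) ^ ('n1 + 'n2) \<Rightarrow> real ^ (('n1 + 'n2) + ('n1 + 'n2)) ^ ('n1 + 'n2)
    \<Rightarrow> (real \<Rightarrow> real ^ 'N1) \<Rightarrow> (real \<Rightarrow> real ^ 'N2) \<Rightarrow> (real \<Rightarrow> real ^ 'N1) \<Rightarrow> (real \<Rightarrow> real ^ 'N2)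
    \<Rightarrow> real ^ (('n1::finite \<times> 'N1::finite) + ('n2::finite \<times> 'N2::finite)) ^ (('n1 \<times> 'N1) + ('n2 \<times> 'N2))" where
  "J_mat P G VB VC \<phi>1 \<phi>2 d\<phi>1 d\<phi>2 =
     D_mat P \<phi>1 \<phi>2 d\<phi>1 d\<phi>2
     - (1/2) *\<^sub>R (D_mat G \<phi>1 \<phi>2 \<phi>1 \<phi>2 - transpose (D_mat G \<phi>1 \<phi>2 \<phi>1 \<phi>2))
     - Omega_ba \<phi>1 \<phi>2 ** transpose VC ** VB ** transpose (Omega_ba \<phi>1 \<phi>2)"

definition R_mat ::
  "real ^ ('n1 + 'n2) ^ ('n1 + 'n2) \<Rightarrow> (real \<Rightarrow> real ^ 'N1) \<Rightarrow> (real \<Rightarrow> real ^ 'N2)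
    \<Rightarrow> real ^ (('n1::finite \<times> 'N1::finite) + ('n2::finite \<times> 'N2::finite)) ^ (('n1 \<times> 'N1) + ('n2 \<times> 'N2))" where
  "R_mat G \<phi>1 \<phi>2 = (1/2) *\<^sub>R (D_mat G \<phi>1 \<phi>2 \<phi>1 \<phi>2 + transpose (D_mat G \<phi>1 \<phi>2 \<phi>1 \<phi>2))"

end

text \<open>
  Trajectories of \<open>E x' = (J - R) e + B u, E e = Q x, y = B\<^sup>T e\<close> for inputs in
  \<open>L\<^sup>2\<^sub>l\<^sub>o\<^sub>c((0,\<infinity>))\<close> are Caratheodory solutions: \<open>x\<close> is continuous on \<open>[0,\<infinity>)\<close>, locally absolutely
  continuous on \<open>(0,\<infinity>)\<close>, and satisfies the differential equation almost everywhere.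
\<close>

definition discrete_system ::
  "real ^ 'm ^ 'm \<Rightarrow> real ^ 'm ^ 'm \<Rightarrow> real ^ 'm ^ 'm \<Rightarrow> real ^ 'm ^ 'm \<Rightarrow> real ^ 'n ^ 'm
    \<Rightarrow> (real ^ 'm::finite, real ^ 'n::finite) system" where
  "discrete_system E Q J R B u x y \<longleftrightarrow>
     (\<forall>s t. 0 < s \<and> s < t \<longrightarrow> L2_fun s t u) \<and>
     continuous_on {0..} x \<and>
     (\<exists>e dx.
        (\<forall>s t. 0 < s \<and> s < t \<longrightarrow> has_ac_derivative s t x dx) \<and>
        (AE t in lebesgue_on {0..}. E *v dx t = (J - R) *v e t + B *v u t) \<and>
        (\<forall>t\<ge>0. E *v e t = Q *v x t) \<and>
        (\<forall>t\<ge>0. y t = transpose B *v e t))"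

definition discrete_energy :: "real ^ 'm ^ 'm \<Rightarrow> real ^ 'm::finite \<Rightarrow> real" where
  "discrete_energy Q x = 1/2 * (x \<bullet> (Q *v x))"

end

theory Submission
  imports Defs
begin

text \<open>
  For a coefficient vector \<open>v\<close> let \<open>f = \<Phi>\<^sup>T v\<close> be the corresponding ansatz function.  All matrices of
  \<open>\<Sigma>\<^sub>d\<close> are Gram matrices, so \<open>v \<bullet> D\<^sup>P v = \<integral> f \<bullet> P f'\<close>, which by partial integration is the boundary term
  \<open>(f(b) \<bullet> P f(b) - f(a) \<bullet> P f(a)) / 2\<close>; this is also the form of \<open>\<Omega> V\<^sub>C\<^sup>T V\<^sub>B \<Omega>\<^sup>T\<close>.  Hence the form of \<open>J\<close>
  vanishes, and the power balance of \<open>\<Sigma>\<^sub>d\<close> has the single dissipation term \<open>\<integral> f \<bullet> G f \<ge> 0\<close>.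

  For the IEP claim, a solution \<open>\<epsilon>\<close> of the linear equation \<open>P \<epsilon>' = G \<epsilon>\<close> is the effort of a stationary
  solution of the BC-PHS.  If the BC-PHS is IEP, its supplied power \<open>\<integral> \<epsilon> \<bullet> G \<epsilon>\<close> is zero, and as
  \<open>\<epsilon>(a)\<close> is arbitrary, \<open>v \<bullet> G v = 0\<close> for all \<open>v\<close>: the dissipation term vanishes.

  For continuous inputs the balance must hold at every \<open>t \<ge> 0\<close>.  There \<open>E\<close> is inverted, so that the
  right-hand side of the state equation is continuous and Caratheodory solutions are classical.
\<close>

subsection \<open>Block matrices and ansatz functions\<close>

lemma sum_UNIV_sum_type:
  "(\<Sum>i\<in>UNIV. f i) = (\<Sum>i\<in>UNIV. f (Inl i)) + (\<Sum>i\<in>UNIV. f (Inr i))"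
  for f :: "'a::finite + 'b::finite \<Rightarrow> 'c::comm_monoid_add"
  by (simp add: UNIV_Plus_UNIV[symmetric] sum.Plus del: UNIV_Plus_UNIV)

lemma inner_vcat: "vcat p q \<bullet> vcat r s = p \<bullet> r + q \<bullet> s"
  by (simp add: inner_vec_def sum_UNIV_sum_type vcat_def)

lemma inner_symmetric_mat:
  "symmetric_mat A \<Longrightarrow> v \<bullet> (A *v w) = w \<bullet> (A *v v)"
  unfolding symmetric_mat_def by (metis dot_lmul_matrix inner_commute transpose_matrix_vector)

lemma inner_transpose_mat: "v \<bullet> (transpose A *v w) = w \<bullet> (A *v v)"
  for A :: "real ^ 'a ^ 'b"
  by (metis dot_lmul_matrix inner_commute transpose_matrix_vector)

lemma block_diag_mult_vec: "block_mat A 0 0 D *v vcat v w = vcat (A *v v) (D *v w)"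
  by (simp add: vec_eq_iff block_mat_def vcat_def matrix_vector_mult_def sum_UNIV_sum_type split: sum.split)

lemma block_diag_mult_mat:
  "block_mat A 0 0 D ** M ** transpose (block_mat A' 0 0 D') =
     block_mat (A ** blk11 M ** transpose A') (A ** blk12 M ** transpose D')
       (D ** blk21 M ** transpose A') (D ** blk22 M ** transpose D')"
  by (simp add: vec_eq_iff block_mat_def vcat_def matrix_matrix_mult_def transpose_def
      blk11_def blk12_def blk21_def blk22_def sum_UNIV_sum_type split: sum.split)

lemma vec_mult_hcat: "v v* hcat A B = vcat (v v* A) (v v* B)"
  by (simp add: vec_eq_iff hcat_def vcat_def vector_matrix_mult_def split: sum.split)

text \<open>Gluing \<open>\<Phi>\<^sub>1\<close> and \<open>\<Phi>\<^sub>2\<close> into one matrix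
  turns the separate block integrals of each discretization matrix into a single integral of
  \<open>Theta ** M ** transpose Theta\<close>.\<close>

definition Theta :: "real ^ 'N1 \<Rightarrow> real ^ 'N2
    \<Rightarrow> real ^ ('n1::finite + 'n2::finite) ^ (('n1 \<times> 'N1::finite) + ('n2 \<times> 'N2::finite))" where
  "Theta p q = block_mat (Phi p) 0 0 (Phi q)"

text \<open>
  \<open>trial v (\<phi>\<^sub>1 z) (\<phi>\<^sub>2 z)\<close> is the value at \<open>z\<close> of the ansatz function with coefficient vector \<open>v\<close>.
\<close>

definition trial :: "real ^ (('n1::finite \<times> 'N1::finite) + ('n2::finite \<times> 'N2::finite))
    \<Rightarrow> real ^ 'N1 \<Rightarrow> real ^ 'N2 \<Rightarrow> real ^ ('n1 + 'n2)" where
  "trial v p q = v v* Theta p q"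

lemma trial_Inl: "trial v p q $ Inl j = (\<Sum>k\<in>UNIV. v $ Inl (j, k) * p $ k)"
proof -
  \<comment> \<open>Row indices of \<open>Phi\<close> are pairs (block, row in block); in the double
    sum only block \<open>j\<close> survives.\<close>
  have "(\<Sum>i\<in>UNIV. if j = fst i then v $ Inl i * p $ snd i else 0) =
      (\<Sum>i\<in>UNIV. \<Sum>k\<in>UNIV. if j = i then v $ Inl (i,k) * p $ k else 0)"
    unfolding sum.cartesian_product UNIV_Times_UNIV by (intro sum.cong) auto
  also have "\<dots> = (\<Sum>k\<in>UNIV. v $ Inl (j, k) * p $ k)"
    by (subst sum.swap) simp
  finally show ?thesis
    by (simp add: trial_def Theta_def vector_matrix_mult_def sum_UNIV_sum_type block_mat_def vcat_def Phi_def
        if_distribR if_distrib cong: if_cong)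
qed

lemma trial_Inr: "trial v p q $ Inr j = (\<Sum>k\<in>UNIV. v $ Inr (j, k) * q $ k)"
proof -
  have "(\<Sum>i\<in>UNIV. if j = fst i then v $ Inr i * q $ snd i else 0) =
      (\<Sum>i\<in>UNIV. \<Sum>k\<in>UNIV. if j = i then v $ Inr (i,k) * q $ k else 0)"
    unfolding sum.cartesian_product UNIV_Times_UNIV by (intro sum.cong) auto
  also have "\<dots> = (\<Sum>k\<in>UNIV. v $ Inr (j, k) * q $ k)"
    by (subst sum.swap) simp
  finally show ?thesis
    by (simp add: trial_def Theta_def vector_matrix_mult_def sum_UNIV_sum_type block_mat_def vcat_def Phi_def
        if_distribR if_distrib cong: if_cong)
qed

text \<open>Linearity in the basis values carries L2 and absolute continuity from the basis to the
  ansatz functions. The other argument is 0 so that \<open>trial_split\<close> can recombine the two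
  parts.\<close>

lemma bounded_linear_trial1: "bounded_linear (\<lambda>p. trial v p 0)"
proof -
  have "linear (\<lambda>p. trial v p 0)"
  proof (rule linearI)
    fix x y and c :: real
    show "trial v (x + y) 0 = trial v x 0 + trial v y 0"
      unfolding vec_eq_iff
    proof
      fix i show "trial v (x + y) 0 $ i = (trial v x 0 + trial v y 0) $ i"
        by (cases i) (simp_all add: trial_Inl trial_Inr algebra_simps sum.distrib)
    qed
    show "trial v (c *\<^sub>R x) 0 = c *\<^sub>R trial v x 0"
      unfolding vec_eq_iff
    proof
      fix i show "trial v (c *\<^sub>R x) 0 $ i = (c *\<^sub>R trial v x 0) $ i"
        by (cases i) (simp_all add: trial_Inl trial_Inr algebra_simps sum_distrib_left)
    qed
  qed
  then show ?thesis by (simp add: linear_conv_bounded_linear)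
qed

lemma bounded_linear_trial2: "bounded_linear (\<lambda>q. trial v 0 q)"
proof -
  have "linear (\<lambda>q. trial v 0 q)"
  proof (rule linearI)
    fix x y and c :: real
    show "trial v 0 (x + y) = trial v 0 x + trial v 0 y"
      unfolding vec_eq_iff
    proof
      fix i show "trial v 0 (x + y) $ i = (trial v 0 x + trial v 0 y) $ i"
        by (cases i) (simp_all add: trial_Inl trial_Inr algebra_simps sum.distrib)
    qed
    show "trial v 0 (c *\<^sub>R x) = c *\<^sub>R trial v 0 x"
      unfolding vec_eq_iff
    proof
      fix i show "trial v 0 (c *\<^sub>R x) $ i = (c *\<^sub>R trial v 0 x) $ i"
        by (cases i) (simp_all add: trial_Inl trial_Inr algebra_simps sum_distrib_left)
    qed
  qed
  then show ?thesis by (simp add: linear_conv_bounded_linear)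
qed

lemma trial_split: "trial v p q = trial v p 0 + trial v 0 q"
  unfolding vec_eq_iff
proof
  fix i show "trial v p q $ i = (trial v p 0 + trial v 0 q) $ i"
    by (cases i) (simp_all add: trial_Inl trial_Inr)
qed

lemma inner_Theta_mult:
  "v \<bullet> ((Theta p q ** M ** transpose (Theta r s)) *v w) = trial v p q \<bullet> (M *v trial w r s)"
  by (simp add: trial_def dot_lmul_matrix flip: matrix_vector_mul_assoc)

text \<open>Reduces integrability of a matrix function to integrability of scalar forms on unit
  vectors.\<close>

lemma mat_entry: "A $ i $ j = axis i 1 \<bullet> (A *v axis j 1)" for A :: "real ^ 'a ^ 'b"
  by (simp add: inner_axis' matrix_vector_mult_basis column_def)

subsection \<open>Square-integrable and absolutely continuous functions\<close>

lemma integrable_vecI: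
  fixes f :: "_ \<Rightarrow> 'b::euclidean_space ^ 'n"
  assumes "\<And>i. integrable M (\<lambda>z. f z $ i)"
  shows "integrable M f"
proof -
  have "integrable M (\<lambda>z. \<Sum>b\<in>Basis. (f z \<bullet> b) *\<^sub>R b)"
  proof (intro Bochner_Integration.integrable_sum integrable_scaleR_left)
    fix b :: "'b ^ 'n" assume "b \<in> Basis"
    then obtain i u where "b = axis i u" "u \<in> Basis" by (auto simp: Basis_vec_def)
    then show "integrable M (\<lambda>z. f z \<bullet> b)"
      using assms[of i] by (simp add: inner_axis)
  qed
  then show ?thesis by (simp add: euclidean_representation)
qed

lemma integral_vec_nth:
  fixes f :: "_ \<Rightarrow> 'b::euclidean_space ^ 'n"
  assumes "integrable M f"
  shows "(LINT z|M. f z) $ i = (LINT z|M. f z $ i)"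
  using integral_bounded_linear[OF bounded_linear_vec_nth assms, of i] by simp

lemma integrable_vec_nth:
  fixes f :: "_ \<Rightarrow> 'b::euclidean_space ^ 'n"
  assumes "integrable M f"
  shows "integrable M (\<lambda>z. f z $ i)"
  using integrable_bounded_linear[OF bounded_linear_vec_nth assms, of i] by simp

text \<open>Integrability of the assembled matrix passes to each entry and thus to each block. It
  has to be assumed: the integral of a non-integrable function is 0 by default, so one bad entry
  would also erase the others on the right-hand side.\<close>

lemma block_mat_integral:
  assumes "integrable M (\<lambda>z. block_mat (A z) (B z) (C z) (D z))"
  shows "block_mat (LINT z|M. A z) (LINT z|M. B z) (LINT z|M. C z) (LINT z|M. D z) =
    (LINT z|M. block_mat (A z) (B z) (C z) (D z))"
proof -
  let ?K = "\<lambda>z. block_mat (A z) (B z) (C z) (D z)"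
  have entry: "integrable M (\<lambda>z. ?K z $ i $ j)" for i j
    using assms by (intro integrable_vec_nth)
  have "integrable M A"
    by (intro integrable_vecI) (use entry[of "Inl _" "Inl _"] in \<open>simp add: block_mat_def vcat_def\<close>)
  moreover have "integrable M B"
    by (intro integrable_vecI) (use entry[of "Inl _" "Inr _"] in \<open>simp add: block_mat_def vcat_def\<close>)
  moreover have "integrable M C"
    by (intro integrable_vecI) (use entry[of "Inr _" "Inl _"] in \<open>simp add: block_mat_def vcat_def\<close>)
  moreover have "integrable M D"
    by (intro integrable_vecI) (use entry[of "Inr _" "Inr _"] in \<open>simp add: block_mat_def vcat_def\<close>)
  ultimately have "block_mat (LINT z|M. A z) (LINT z|M. B z) (LINT z|M. C z) (LINT z|M. D z) $ i $ j =
      (LINT z|M. ?K z $ i $ j)" for i j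
    by (cases i; cases j) (simp_all add: block_mat_def vcat_def integral_vec_nth integrable_vec_nth)
  moreover have "(LINT z|M. ?K z) $ i $ j = (LINT z|M. ?K z $ i $ j)" for i j
    using assms by (simp only: integral_vec_nth integrable_vec_nth)
  ultimately have "block_mat (LINT z|M. A z) (LINT z|M. B z) (LINT z|M. C z) (LINT z|M. D z) $ i $ j =
      (LINT z|M. ?K z) $ i $ j" for i j
    by (simp only:)
  then show ?thesis by (simp add: vec_eq_iff)
qed

section \<open>Square-integrable functions on an interval\<close>

lemma L2_funD:
  assumes "L2_fun a b f"
  shows "f \<in> borel_measurable (lebesgue_on {a..b})" "integrable (lebesgue_on {a..b}) (\<lambda>z. (norm (f z))\<^sup>2)"
  using assms by (auto simp: L2_fun_def)

lemma L2_fun_dominated: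
  assumes "f \<in> borel_measurable (lebesgue_on {a..b})" "L2_fun a b g"
    and "\<And>z. z \<in> {a..b} \<Longrightarrow> norm (f z) \<le> c * norm (g z)"
  shows "L2_fun a b f"
  unfolding L2_fun_def
proof (rule conjI[OF assms(1)], rule Bochner_Integration.integrable_bound)
  show "integrable (lebesgue_on {a..b}) (\<lambda>z. c\<^sup>2 * (norm (g z))\<^sup>2)"
    using L2_funD(2)[OF assms(2)] by simp
  show "(\<lambda>z. (norm (f z))\<^sup>2) \<in> borel_measurable (lebesgue_on {a..b})"
    using assms(1) by measurable
  show "AE z in lebesgue_on {a..b}. norm ((norm (f z))\<^sup>2) \<le> norm (c\<^sup>2 * (norm (g z))\<^sup>2)"
  proof (rule AE_I2)
    fix z assume "z \<in> space (lebesgue_on {a..b})"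
    then have "(norm (f z))\<^sup>2 \<le> (c * norm (g z))\<^sup>2"
      using assms(3) by (intro power_mono) auto
    then show "norm ((norm (f z))\<^sup>2) \<le> norm (c\<^sup>2 * (norm (g z))\<^sup>2)"
      by (simp add: power_mult_distrib)
  qed
qed

lemma L2_fun_bounded_linear:
  assumes "bounded_linear T" "L2_fun a b f"
  shows "L2_fun a b (\<lambda>z. T (f z))"
proof (rule L2_fun_dominated[OF _ assms(2)])
  show "(\<lambda>z. T (f z)) \<in> borel_measurable (lebesgue_on {a..b})"
    using L2_funD(1)[OF assms(2)] assms(1) bounded_linear.linear
    by (intro borel_measurable_continuous_on[where f=T]) (auto simp: linear_continuous_on)
  show "norm (T (f z)) \<le> onorm T * norm (f z)" for z
    by (rule onorm[OF assms(1)])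
qed

lemma L2_fun_inner:
  assumes "L2_fun a b f" "L2_fun a b g"
  shows "integrable (lebesgue_on {a..b}) (\<lambda>z. f z \<bullet> g z)"
proof (rule Bochner_Integration.integrable_bound)
  show "integrable (lebesgue_on {a..b}) (\<lambda>z. (norm (f z))\<^sup>2 + (norm (g z))\<^sup>2)"
    using assms by (intro Bochner_Integration.integrable_add L2_funD(2))
  show "(\<lambda>z. f z \<bullet> g z) \<in> borel_measurable (lebesgue_on {a..b})"
    using assms[THEN L2_funD(1)] by (rule borel_measurable_inner)
  \<comment> \<open>A crude form of Young's inequality is enough for domination.\<close>
  have "\<bar>x \<bullet> y\<bar> \<le> (norm x)\<^sup>2 + (norm y)\<^sup>2" for x y :: 'a
  proof -
    have "0 \<le> (norm x - norm y)\<^sup>2" "0 \<le> norm x * norm y" by auto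
    then have "norm x * norm y \<le> (norm x)\<^sup>2 + (norm y)\<^sup>2"
      unfolding power2_diff by linarith
    then show ?thesis using Cauchy_Schwarz_ineq2[of x y] by linarith
  qed
  then show "AE z in lebesgue_on {a..b}. norm (f z \<bullet> g z) \<le> norm ((norm (f z))\<^sup>2 + (norm (g z))\<^sup>2)"
    by (auto intro!: AE_I2 order_trans[OF _ abs_ge_self])
qed

lemma L2_fun_add:
  assumes "L2_fun a b f" "L2_fun a b g"
  shows "L2_fun a b (\<lambda>z. f z + g z)"
  unfolding L2_fun_def
proof
  show "(\<lambda>z. f z + g z) \<in> borel_measurable (lebesgue_on {a..b})"
    using assms[THEN L2_funD(1)] by (rule borel_measurable_add)
  have "(norm (f z + g z))\<^sup>2 = (norm (f z))\<^sup>2 + 2 * (f z \<bullet> g z) + (norm (g z))\<^sup>2" for z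
    by (simp add: power2_norm_eq_inner inner_add inner_commute)
  then show "integrable (lebesgue_on {a..b}) (\<lambda>z. (norm (f z + g z))\<^sup>2)"
    using L2_fun_inner[OF assms] assms[THEN L2_funD(2)] by simp
qed

lemma continuous_imp_L2_fun:
  fixes f :: "real \<Rightarrow> 'v::euclidean_space"
  assumes "continuous_on {a..b} f"
  shows "L2_fun a b f"
  unfolding L2_fun_def
  using assms by (intro conjI continuous_imp_integrable_real continuous_imp_measurable_on_sets_lebesgue continuous_intros) auto

lemma bounded_bilinear_matrix_vector_mult:
  "bounded_bilinear ((*v) :: real ^ 'k ^ 'm \<Rightarrow> real ^ 'k \<Rightarrow> real ^ 'm)"
  unfolding bilinear_conv_bounded_bilinear[symmetric] bilinear_def
  by (intro conjI allI linearI)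
    (simp_all add: vec_eq_iff matrix_vector_mult_def sum.distrib sum_distrib_left algebra_simps)

text \<open>A continuous coefficient is bounded on the compact interval, so multiplication by it
  preserves L2.\<close>

lemma L2_fun_mat_mult:
  assumes A: "continuous_on {a..b} A" and f: "L2_fun a b f"
  shows "L2_fun a b (\<lambda>z. (A z :: real ^ 'k ^ 'm) *v f z)"
proof -
  have m: "A \<in> borel_measurable (lebesgue_on {a..b})"
    using A by (intro continuous_imp_measurable_on_sets_lebesgue) auto
  obtain c where c: "\<And>z. z \<in> {a..b} \<Longrightarrow> norm (A z) \<le> c"
    using compact_imp_bounded[OF compact_continuous_image[OF A compact_Icc]]
    unfolding bounded_iff by blast
  obtain K where K: "0 < K" "\<And>(M :: real ^ 'k ^ 'm) v. norm (M *v v) \<le> norm M * norm v * K"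
    using bounded_bilinear.pos_bounded[OF bounded_bilinear_matrix_vector_mult] by blast
  show ?thesis
  proof (rule L2_fun_dominated[OF _ f])
    show "(\<lambda>z. A z *v f z) \<in> borel_measurable (lebesgue_on {a..b})"
      using m L2_funD(1)[OF f]
    proof (rule borel_measurable_continuous_Pair)
      show "continuous_on UNIV (\<lambda>x :: (real ^ 'k ^ 'm) \<times> (real ^ 'k). fst x *v snd x)"
        by (intro bounded_bilinear.continuous_on[OF bounded_bilinear_matrix_vector_mult] continuous_intros)
    qed
    fix z assume "z \<in> {a..b}"
    then have "norm (A z) * norm (f z) * K \<le> c * norm (f z) * K"
      using c K(1) by (intro mult_right_mono) auto
    then show "norm (A z *v f z) \<le> (c * K) * norm (f z)"
      using K(2)[of "A z" "f z"] by (simp add: mult.commute mult.left_commute)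
  qed
qed

section \<open>Absolutely continuous functions and integration by parts\<close>

lemma integral_if_lebesgue_on:
  fixes f :: "real \<Rightarrow> 'b::euclidean_space"
  assumes "S \<subseteq> T" "S \<in> sets lebesgue" "T \<in> sets lebesgue"
  shows "(LINT s|lebesgue_on T. (if s \<in> S then f s else 0)) = (LINT s|lebesgue_on S. f s)"
  using assms
  by (simp add: integral_restrict_space)
     (intro Bochner_Integration.integral_cong, auto simp: indicator_def)

text \<open>Subtract the integral identity anchored at \<open>a\<close> for \<open>s\<close> from
  the one for \<open>t\<close>; the pieces are combined as Henstock-Kurzweil integrals, with which
  the Lebesgue integrals agree.\<close>

lemma ac_integral_between:
  fixes f :: "real \<Rightarrow> 'v::euclidean_space"
  assumes int: "integrable (lebesgue_on {a..b}) f'"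
    and ftc: "\<forall>z\<in>{a..b}. f z = f a + (LINT s|lebesgue_on {a..z}. f' s)"
    and st: "a \<le> s" "s \<le> t" "t \<le> b"
  shows "(LINT z|lebesgue_on {s..t}. f' z) = f t - f s"
proof -
  have sub: "integrable (lebesgue_on {c..d}) f'" if "a \<le> c" "d \<le> b" for c d
    using integrable_subinterval[OF int] that by auto
  have eq: "(LINT z|lebesgue_on {c..d}. f' z) = integral {c..d} f'" if "a \<le> c" "d \<le> b" for c d
    using sub[OF that] by (simp add: lebesgue_integral_eq_integral)
  have "integral {a..s} f' + integral {s..t} f' = integral {a..t} f'"
    using st sub[of a t] by (intro Henstock_Kurzweil_Integration.integral_combine) (auto intro: integrable_on_lebesgue_on)
  then show ?thesis
    using st ftc[rule_format, of s] ftc[rule_format, of t] by (simp add: eq algebra_simps)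
qed

lemma ac_integral_continuous_on:
  fixes f :: "real \<Rightarrow> 'v::euclidean_space"
  assumes "integrable (lebesgue_on {a..b}) f'"
    and ftc: "\<forall>z\<in>{a..b}. f z = f a + (LINT s|lebesgue_on {a..z}. f' s)"
  shows "continuous_on {a..b} f"
proof (rule continuous_on_eq)
  show "continuous_on {a..b} (\<lambda>z. f a + (LINT s|lebesgue_on {a..z}. f' s))"
    by (intro continuous_intros indefinite_integral_continuous_real assms(1))
qed (rule ftc[rule_format, symmetric])

text \<open>Fubini on the triangle s <= t for the integrand f'(s) g'(t): integrating over s first
  gives the integral of (f(t) - f(a)) g'(t), over t first that of f'(s) (g(b) - g(s)). Equating the
  two is the claim.\<close>

lemma ac_integration_by_parts:
  fixes f g :: "real \<Rightarrow> real"
  assumes ab: "a \<le> b"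
    and f': "integrable (lebesgue_on {a..b}) f'"
    and f: "\<forall>z\<in>{a..b}. f z = f a + (LINT s|lebesgue_on {a..z}. f' s)"
    and g': "integrable (lebesgue_on {a..b}) g'"
    and g: "\<forall>z\<in>{a..b}. g z = g a + (LINT s|lebesgue_on {a..z}. g' s)"
  shows "(LINT z|lebesgue_on {a..b}. f z * g' z + f' z * g z) = f b * g b - f a * g a"
proof -
  let ?M = "lebesgue_on {a..b}"
  have "finite_measure ?M"
    by (rule finite_measure_lebesgue_on) simp
  then have "sigma_finite_measure ?M"
    by (rule finite_measure.axioms)
  then interpret pair_sigma_finite ?M ?M by (simp add: pair_sigma_finite_def)
  have [measurable]: "f' \<in> borel_measurable ?M" "g' \<in> borel_measurable ?M"
    using f' g' by auto
  have [measurable]: "(\<lambda>s. s) \<in> borel_measurable ?M"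
    by (intro continuous_imp_measurable_on_sets_lebesgue continuous_intros) auto
  \<comment> \<open>The product on the whole square is integrable and dominates its restriction to
    the triangle.\<close>
  have prod: "integrable (?M \<Otimes>\<^sub>M ?M) (\<lambda>(s, t). f' s * g' t)"
    using f' g' by (intro Fubini_integrable) (auto simp: abs_mult)
  have "integrable (?M \<Otimes>\<^sub>M ?M) (\<lambda>(s, t). if s \<le> t then f' s * g' t else 0)"
    by (rule Bochner_Integration.integrable_bound[OF prod]) (measurable, auto)
  then have swap: "(LINT t|?M. LINT s|?M. (if s \<le> t then f' s * g' t else 0)) =
      (LINT s|?M. LINT t|?M. (if s \<le> t then f' s * g' t else 0))"
    by (rule Fubini_integral)
  have "(LINT s|?M. (if s \<le> t then f' s * g' t else 0)) = (f t - f a) * g' t" if "t \<in> {a..b}" for t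
  proof -
    have "(LINT s|?M. (if s \<le> t then f' s * g' t else 0)) = (LINT s|?M. (if s \<in> {a..t} then f' s else 0) * g' t)"
      by (intro Bochner_Integration.integral_cong) auto
    also have "\<dots> = (LINT s|?M. (if s \<in> {a..t} then f' s else 0)) * g' t" by simp
    finally show ?thesis
      using that integral_if_lebesgue_on[of "{a..t}" "{a..b}" f'] ac_integral_between[OF f' f, of a t] by simp
  qed
  then have 1: "(LINT t|?M. LINT s|?M. (if s \<le> t then f' s * g' t else 0)) = (LINT t|?M. (f t - f a) * g' t)"
    by (intro Bochner_Integration.integral_cong) auto
  have "(LINT t|?M. (if s \<le> t then f' s * g' t else 0)) = f' s * (g b - g s)" if "s \<in> {a..b}" for s
  proof -
    have "(LINT t|?M. (if s \<le> t then f' s * g' t else 0)) = (LINT t|?M. f' s * (if t \<in> {s..b} then g' t else 0))"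
      by (intro Bochner_Integration.integral_cong) auto
    also have "\<dots> = f' s * (LINT t|?M. (if t \<in> {s..b} then g' t else 0))" by simp
    finally show ?thesis
      using that integral_if_lebesgue_on[of "{s..b}" "{a..b}" g'] ac_integral_between[OF g' g, of s b] by simp
  qed
  then have 2: "(LINT s|?M. LINT t|?M. (if s \<le> t then f' s * g' t else 0)) = (LINT s|?M. f' s * (g b - g s))"
    by (intro Bochner_Integration.integral_cong) auto
  have cont: "continuous_on {a..b} f" "continuous_on {a..b} g"
    using ac_integral_continuous_on[OF f' f] ac_integral_continuous_on[OF g' g] by auto
  \<comment> \<open>Continuous functions are bounded on the compact interval, so
    \<open>f * g'\<close> and \<open>f' * g\<close> are separately integrable and the integrals
    above can be split.\<close>
  have bdd: "integrable ?M (\<lambda>z. p z * q z)" if p: "continuous_on {a..b} p" and q: "integrable ?M q" for p q :: "real \<Rightarrow> real"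
  proof -
    obtain c where c: "\<And>z. z \<in> {a..b} \<Longrightarrow> norm (p z) \<le> c"
      using compact_imp_bounded[OF compact_continuous_image[OF p compact_Icc]]
      unfolding bounded_iff by blast
    have "p \<in> borel_measurable ?M"
      using p by (intro continuous_imp_measurable_on_sets_lebesgue) auto
    show ?thesis
    proof (rule Bochner_Integration.integrable_bound)
      show "integrable ?M (\<lambda>z. c * norm (q z))" using q by auto
      show "(\<lambda>z. p z * q z) \<in> borel_measurable ?M"
        using q \<open>p \<in> borel_measurable ?M\<close> by auto
      show "AE z in ?M. norm (p z * q z) \<le> norm (c * norm (q z))"
      proof (rule AE_I2)
        fix z assume "z \<in> space ?M"
        then have "norm (p z) * norm (q z) \<le> c * norm (q z)"
          using c by (intro mult_right_mono) auto
        then show "norm (p z * q z) \<le> norm (c * norm (q z))"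
          by (metis abs_ge_self norm_mult order_trans real_norm_def)
      qed
    qed
  qed
  have fg: "integrable ?M (\<lambda>z. f z * g' z)" "integrable ?M (\<lambda>z. f' z * g z)"
    using bdd[OF cont(1) g'] bdd[OF cont(2) f'] by (simp_all add: mult.commute)
  have "(LINT t|?M. f t * g' t) - f a * (g b - g a) = (f b - f a) * g b - (LINT t|?M. f' t * g t)"
    using swap fg f' g' ac_integral_between[OF f' f, of a b] ac_integral_between[OF g' g, of a b] ab
    unfolding 1 2 by (simp add: algebra_simps)
  then show ?thesis using fg by (simp add: algebra_simps)
qed

lemma has_ac_derivative_imp_continuous_on:
  "has_ac_derivative a b f f' \<Longrightarrow> continuous_on {a..b} f"
  unfolding has_ac_derivative_def by (blast intro: ac_integral_continuous_on)

lemma has_ac_derivative_bounded_linear: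
  assumes T: "bounded_linear T" and f: "has_ac_derivative a b f f'"
  shows "has_ac_derivative a b (\<lambda>z. T (f z)) (\<lambda>z. T (f' z))"
  unfolding has_ac_derivative_def
proof (intro conjI ballI)
  have int: "integrable (lebesgue_on {a..b}) f'"
    using f unfolding has_ac_derivative_def by blast
  then show "integrable (lebesgue_on {a..b}) (\<lambda>z. T (f' z))"
    by (rule integrable_bounded_linear[OF T])
  have "AE z in lebesgue_on {a..b}. (f has_vector_derivative f' z) (at z within {a..b})"
    using f unfolding has_ac_derivative_def by blast
  then show "AE z in lebesgue_on {a..b}. ((\<lambda>z. T (f z)) has_vector_derivative T (f' z)) (at z within {a..b})"
    by eventually_elim (rule bounded_linear.has_vector_derivative[OF T])
  fix z assume z: "z \<in> {a..b}"
  have "f z = f a + (LINT s|lebesgue_on {a..z}. f' s)"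
    using z f unfolding has_ac_derivative_def by blast
  moreover have "integrable (lebesgue_on {a..z}) f'"
    using integrable_subinterval[OF int] z by auto
  ultimately show "T (f z) = T (f a) + (LINT s|lebesgue_on {a..z}. T (f' s))"
    by (simp add: integral_bounded_linear[OF T] linear_add[OF bounded_linear.linear[OF T]])
qed

lemma has_ac_derivative_add:
  assumes f: "has_ac_derivative a b f f'" and g: "has_ac_derivative a b g g'"
  shows "has_ac_derivative a b (\<lambda>z. f z + g z) (\<lambda>z. f' z + g' z)"
  unfolding has_ac_derivative_def
proof (intro conjI ballI)
  have int: "integrable (lebesgue_on {a..b}) f'" "integrable (lebesgue_on {a..b}) g'"
    using f g unfolding has_ac_derivative_def by blast+
  then show "integrable (lebesgue_on {a..b}) (\<lambda>z. f' z + g' z)"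
    by (rule Bochner_Integration.integrable_add)
  have "AE z in lebesgue_on {a..b}. (f has_vector_derivative f' z) (at z within {a..b})"
    "AE z in lebesgue_on {a..b}. (g has_vector_derivative g' z) (at z within {a..b})"
    using f g unfolding has_ac_derivative_def by blast+
  then show "AE z in lebesgue_on {a..b}. ((\<lambda>z. f z + g z) has_vector_derivative f' z + g' z) (at z within {a..b})"
    by eventually_elim (rule has_vector_derivative_add)
  fix z assume z: "z \<in> {a..b}"
  have "f z = f a + (LINT s|lebesgue_on {a..z}. f' s)" "g z = g a + (LINT s|lebesgue_on {a..z}. g' s)"
    using z f g unfolding has_ac_derivative_def by blast+
  moreover have "integrable (lebesgue_on {a..z}) f'" "integrable (lebesgue_on {a..z}) g'"
    using int[THEN integrable_subinterval, of a z] z by auto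
  ultimately show "f z + g z = f a + g a + (LINT s|lebesgue_on {a..z}. f' s + g' s)"
    by simp
qed

text \<open>By symmetry of \<open>P\<close>, twice the integrand is f . P f' + f' . P f, formally
  the derivative of f . P f. Expanded in coordinates, this is scalar integration by parts for each
  pair of components.\<close>

lemma ac_inner_symmetric_by_parts:
  fixes f :: "real \<Rightarrow> real ^ 'n"
  assumes ab: "a \<le> b" and P: "symmetric_mat P"
    and f: "has_ac_derivative a b f f'" and L2: "L2_fun a b f" "L2_fun a b f'"
  shows "2 * (LINT z|lebesgue_on {a..b}. f z \<bullet> (P *v f' z)) = f b \<bullet> (P *v f b) - f a \<bullet> (P *v f a)"
proof -
  have comp: "has_ac_derivative a b (\<lambda>z. f z $ i) (\<lambda>z. f' z $ i)" for i
    by (rule has_ac_derivative_bounded_linear[OF bounded_linear_vec_nth f])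
  have L2c: "L2_fun a b (\<lambda>z. f z $ i)" "L2_fun a b (\<lambda>z. f' z $ i)" for i
    using L2 by (auto intro: L2_fun_bounded_linear[OF bounded_linear_vec_nth])
  have int: "integrable (lebesgue_on {a..b}) (\<lambda>z. f z $ i * f' z $ j)"
    "integrable (lebesgue_on {a..b}) (\<lambda>z. f' z $ i * f z $ j)" for i j
    using L2_fun_inner[OF L2c(1)[of i] L2c(2)[of j]] L2_fun_inner[OF L2c(2)[of i] L2c(1)[of j]] by simp_all
  have "2 * (f z \<bullet> (P *v f' z)) =
      (\<Sum>i\<in>UNIV. \<Sum>j\<in>UNIV. P $ i $ j * (f z $ i * f' z $ j + f' z $ i * f z $ j))" for z
  proof -
    have "2 * (f z \<bullet> (P *v f' z)) = f z \<bullet> (P *v f' z) + f' z \<bullet> (P *v f z)"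
      using inner_symmetric_mat[OF P, of "f z" "f' z"] by simp
    then show ?thesis
      by (simp add: inner_vec_def matrix_vector_mult_def sum_distrib_left sum.distrib algebra_simps)
  qed
  then have "2 * (LINT z|lebesgue_on {a..b}. f z \<bullet> (P *v f' z)) =
      (LINT z|lebesgue_on {a..b}. (\<Sum>i\<in>UNIV. \<Sum>j\<in>UNIV. P $ i $ j * (f z $ i * f' z $ j + f' z $ i * f z $ j)))"
    by (simp only: integral_mult_right_zero[symmetric])
  also have "\<dots> = (\<Sum>i\<in>UNIV. \<Sum>j\<in>UNIV. P $ i $ j * (LINT z|lebesgue_on {a..b}. f z $ i * f' z $ j + f' z $ i * f z $ j))"
    using int by simp
  also have "\<dots> = (\<Sum>i\<in>UNIV. \<Sum>j\<in>UNIV. P $ i $ j * (f b $ i * f b $ j - f a $ i * f a $ j))"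
    using comp unfolding has_ac_derivative_def
    by (intro sum.cong refl arg_cong2[where f="(*)"] ac_integration_by_parts[OF ab]) blast+
  also have "\<dots> = f b \<bullet> (P *v f b) - f a \<bullet> (P *v f a)"
    by (simp add: inner_vec_def matrix_vector_mult_def sum_distrib_left sum_subtractf algebra_simps)
  finally show ?thesis .
qed

subsection \<open>The discretization matrices as Gram matrices\<close>

lemma L2_fun_trial:
  assumes "L2_fun a b \<phi>1" "L2_fun a b \<phi>2"
  shows "L2_fun a b (\<lambda>z. trial v (\<phi>1 z) (\<phi>2 z))"
  by (subst trial_split)
    (intro L2_fun_add L2_fun_bounded_linear[OF bounded_linear_trial1]
      L2_fun_bounded_linear[OF bounded_linear_trial2] assms)

lemma has_ac_derivative_trial:
  assumes "has_ac_derivative a b \<phi>1 d\<phi>1" "has_ac_derivative a b \<phi>2 d\<phi>2"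
  shows "has_ac_derivative a b (\<lambda>z. trial v (\<phi>1 z) (\<phi>2 z)) (\<lambda>z. trial v (d\<phi>1 z) (d\<phi>2 z))"
  by (subst (1 2) trial_split)
    (intro has_ac_derivative_add has_ac_derivative_bounded_linear[OF bounded_linear_trial1]
      has_ac_derivative_bounded_linear[OF bounded_linear_trial2] assms)

text \<open>Each component of the ansatz function is a linear combination of \<open>\<phi>1\<close>
  or of \<open>\<phi>2\<close> with its own slice of \<open>v\<close> as coefficients, so linear
  independence applies to one component at a time.\<close>

lemma trial_0_eq_0D:
  assumes zero: "\<And>z. z \<in> {a..b} \<Longrightarrow> trial v (\<phi>1 z) (\<phi>2 z) = (0 :: real ^ ('n1::finite + 'n2::finite))"
    and ind1: "\<And>c. (\<forall>z\<in>{a..b}. (\<Sum>k\<in>UNIV. c k * \<phi>1 z $ k) = 0) \<Longrightarrow> (\<forall>k. c k = 0)"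
    and ind2: "\<And>c. (\<forall>z\<in>{a..b}. (\<Sum>k\<in>UNIV. c k * \<phi>2 z $ k) = 0) \<Longrightarrow> (\<forall>k. c k = 0)"
  shows "v = 0"
proof -
  have "v $ Inl (j, k) = 0" for j k
  proof -
    have "(\<Sum>k\<in>UNIV. v $ Inl (j, k) * \<phi>1 z $ k) = 0" if "z \<in> {a..b}" for z
      using zero[OF that] trial_Inl[of v "\<phi>1 z" "\<phi>2 z" j] by simp
    then show ?thesis using ind1[of "\<lambda>k. v $ Inl (j, k)"] by blast
  qed
  moreover have "v $ Inr (j, k) = 0" for j k
  proof -
    have "(\<Sum>k\<in>UNIV. v $ Inr (j, k) * \<phi>2 z $ k) = 0" if "z \<in> {a..b}" for z
      using zero[OF that] trial_Inr[of v "\<phi>1 z" "\<phi>2 z" j] by simp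
    then show ?thesis using ind2[of "\<lambda>k. v $ Inr (j, k)"] by blast
  qed
  ultimately have "v $ i = 0" for i
    by (cases i) (metis surj_pair)+
  then show ?thesis by (simp add: vec_eq_iff)
qed

text \<open>The common form of \<open>E\<close> (with \<open>M\<close> the identity),
  \<open>Q\<close> (with \<open>M = H\<close>, whence the dependence on the point),
  \<open>D\<^sup>P\<close> (with \<open>M = P\<close> and \<open>\<psi>\<close> the derivative of
  \<open>\<phi>\<close>) and \<open>D\<^sup>G\<close> (with \<open>M = G\<close>).\<close>

definition gram :: "real \<Rightarrow> real \<Rightarrow> (real \<Rightarrow> real ^ ('n1 + 'n2) ^ ('n1 + 'n2))
    \<Rightarrow> (real \<Rightarrow> real ^ 'N1) \<Rightarrow> (real \<Rightarrow> real ^ 'N2) \<Rightarrow> (real \<Rightarrow> real ^ 'N1) \<Rightarrow> (real \<Rightarrow> real ^ 'N2)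
    \<Rightarrow> real ^ (('n1::finite \<times> 'N1::finite) + ('n2::finite \<times> 'N2::finite)) ^ (('n1 \<times> 'N1) + ('n2 \<times> 'N2))" where
  "gram a b M \<phi>1 \<phi>2 \<psi>1 \<psi>2 =
     (LINT z|lebesgue_on {a..b}. Theta (\<phi>1 z) (\<phi>2 z) ** M z ** transpose (Theta (\<psi>1 z) (\<psi>2 z)))"

context
  fixes a b :: real and M :: "real \<Rightarrow> real ^ ('n1::finite + 'n2::finite) ^ ('n1 + 'n2)"
    and \<phi>1 \<psi>1 :: "real \<Rightarrow> real ^ 'N1::finite" and \<phi>2 \<psi>2 :: "real \<Rightarrow> real ^ 'N2::finite"
  assumes L2: "L2_fun a b \<phi>1" "L2_fun a b \<phi>2" "L2_fun a b \<psi>1" "L2_fun a b \<psi>2"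
    and M: "continuous_on {a..b} M"
begin

lemma integrable_trial_form:
  "integrable (lebesgue_on {a..b}) (\<lambda>z. trial v (\<phi>1 z) (\<phi>2 z) \<bullet> (M z *v trial w (\<psi>1 z) (\<psi>2 z)))"
  by (intro L2_fun_inner L2_fun_mat_mult L2_fun_trial L2 M)

lemma integrable_gram:
  "integrable (lebesgue_on {a..b}) (\<lambda>z. Theta (\<phi>1 z) (\<phi>2 z) ** M z ** transpose (Theta (\<psi>1 z) (\<psi>2 z)))"
  using integrable_trial_form
  by (intro integrable_vecI) (simp add: mat_entry[of "_ ** _"] inner_Theta_mult)

text \<open>For fixed vectors, evaluating the form is bounded linear in the matrix, hence commutes
  with the integral.\<close>

lemma inner_gram:
  "v \<bullet> (gram a b M \<phi>1 \<phi>2 \<psi>1 \<psi>2 *v w) =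
     (LINT z|lebesgue_on {a..b}. trial v (\<phi>1 z) (\<phi>2 z) \<bullet> (M z *v trial w (\<psi>1 z) (\<psi>2 z)))"
proof -
  have "bounded_linear (\<lambda>A :: real ^ (('n1 \<times> 'N1) + ('n2 \<times> 'N2)) ^ (('n1 \<times> 'N1) + ('n2 \<times> 'N2)). v \<bullet> (A *v w))"
    by (intro bounded_linear_inner_right_comp
        bounded_bilinear.bounded_linear_left[OF bounded_bilinear_matrix_vector_mult])
  from integral_bounded_linear[OF this integrable_gram]
  show ?thesis by (simp add: gram_def inner_Theta_mult)
qed

lemma block_mat_eq_gram:
  "block_mat
     (LINT z|lebesgue_on {a..b}. Phi (\<phi>1 z) ** blk11 (M z) ** transpose (Phi (\<psi>1 z)))
     (LINT z|lebesgue_on {a..b}. Phi (\<phi>1 z) ** blk12 (M z) ** transpose (Phi (\<psi>2 z)))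
     (LINT z|lebesgue_on {a..b}. Phi (\<phi>2 z) ** blk21 (M z) ** transpose (Phi (\<psi>1 z)))
     (LINT z|lebesgue_on {a..b}. Phi (\<phi>2 z) ** blk22 (M z) ** transpose (Phi (\<psi>2 z)))
   = gram a b M \<phi>1 \<phi>2 \<psi>1 \<psi>2"
  using integrable_gram unfolding gram_def Theta_def block_diag_mult_mat by (rule block_mat_integral)

end

lemma D_mat_eq_gram:
  assumes "L2_fun a b \<phi>1" "L2_fun a b \<phi>2" "L2_fun a b \<psi>1" "L2_fun a b \<psi>2"
  shows "D_mat a b M \<phi>1 \<phi>2 \<psi>1 \<psi>2 = gram a b (\<lambda>_. M) \<phi>1 \<phi>2 \<psi>1 \<psi>2"
  unfolding D_mat_def by (rule block_mat_eq_gram[OF assms]) simp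

text \<open>\<open>Q_mat\<close> has zero off-diagonal blocks by construction, while
  \<open>gram\<close> integrates \<open>blk12\<close> and \<open>blk21\<close> of \<open>H\<close>;
  block-diagonality of \<open>H\<close> on the interval makes these integrals vanish.\<close>

lemma Q_mat_eq_gram:
  assumes "L2_fun a b \<phi>1" "L2_fun a b \<phi>2" "continuous_on {a..b} H"
    and diag: "\<And>z. z \<in> {a..b} \<Longrightarrow> blk12 (H z) = 0 \<and> blk21 (H z) = 0"
  shows "Q_mat a b H \<phi>1 \<phi>2 = gram a b H \<phi>1 \<phi>2 \<phi>1 \<phi>2"
proof -
  have "(LINT z|lebesgue_on {a..b}. Phi (\<phi>1 z) ** blk12 (H z) ** transpose (Phi (\<phi>2 z))) = 0"
    "(LINT z|lebesgue_on {a..b}. Phi (\<phi>2 z) ** blk21 (H z) ** transpose (Phi (\<phi>1 z))) = 0"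
    by (intro integral_eq_zero_AE AE_I2; simp add: diag matrix_matrix_mult_def zero_vec_def)+
  then show ?thesis
    using block_mat_eq_gram[of a b \<phi>1 \<phi>2 \<phi>1 \<phi>2 H] assms by (simp add: Q_mat_def)
qed

lemma E_mat_eq_gram:
  assumes "L2_fun a b \<phi>1" "L2_fun a b \<phi>2"
  shows "E_mat a b \<phi>1 \<phi>2 = gram a b (\<lambda>_. mat 1) \<phi>1 \<phi>2 \<phi>1 \<phi>2"
proof -
  have blk: "blk11 (mat 1) = mat 1" "blk12 (mat 1) = 0" "blk21 (mat 1) = 0" "blk22 (mat 1) = mat 1"
    by (simp_all add: vec_eq_iff mat_def blk11_def blk12_def blk21_def blk22_def)
  \<comment> \<open>The mass matrix is the case of \<open>Q_mat\<close> in which \<open>H\<close> is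
    the identity.\<close>
  have "Q_mat a b (\<lambda>_. mat 1) \<phi>1 \<phi>2 = gram a b (\<lambda>_. mat 1) \<phi>1 \<phi>2 \<phi>1 \<phi>2"
    by (rule Q_mat_eq_gram[OF assms]) (simp_all add: blk)
  then show ?thesis by (simp add: Q_mat_def E_mat_def blk)
qed

lemma symmetric_gram:
  assumes L2: "L2_fun a b \<phi>1" "L2_fun a b \<phi>2" and H: "continuous_on {a..b} H"
    and sym: "\<And>z. z \<in> {a..b} \<Longrightarrow> symmetric_mat (H z)"
  shows "v \<bullet> (gram a b H \<phi>1 \<phi>2 \<phi>1 \<phi>2 *v w) = w \<bullet> (gram a b H \<phi>1 \<phi>2 \<phi>1 \<phi>2 *v v)"
  unfolding inner_gram[OF L2 L2 H]
  by (intro Bochner_Integration.integral_cong) (auto intro!: inner_symmetric_mat sym)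

lemma gram_nonneg:
  assumes L2: "L2_fun a b \<phi>1" "L2_fun a b \<phi>2" and H: "continuous_on {a..b} H"
    and pos: "\<And>z x. z \<in> {a..b} \<Longrightarrow> 0 \<le> x \<bullet> (H z *v x)"
  shows "0 \<le> v \<bullet> (gram a b H \<phi>1 \<phi>2 \<phi>1 \<phi>2 *v v)"
  unfolding inner_gram[OF L2 L2 H] by (intro Bochner_Integration.integral_nonneg) (auto intro!: pos)

text \<open>If \<open>E v = 0\<close>, the squared norm of the ansatz function has integral 0. This
  function is continuous, so it vanishes at every point of the nondegenerate interval, and linear
  independence gives \<open>v = 0\<close>.\<close>

lemma E_mat_injective:
  fixes v :: "real ^ (('n1::finite \<times> 'N1::finite) + ('n2::finite \<times> 'N2::finite))"
  assumes "a < b" and H1: "has_H1_derivative a b \<phi>1 d\<phi>1" "has_H1_derivative a b \<phi>2 d\<phi>2"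
    and ind: "\<And>c. (\<forall>z\<in>{a..b}. (\<Sum>k\<in>UNIV. c k * \<phi>1 z $ k) = 0) \<Longrightarrow> (\<forall>k. c k = 0)"
      "\<And>c. (\<forall>z\<in>{a..b}. (\<Sum>k\<in>UNIV. c k * \<phi>2 z $ k) = 0) \<Longrightarrow> (\<forall>k. c k = 0)"
    and Ev: "E_mat a b \<phi>1 \<phi>2 *v v = 0"
  shows "v = 0"
proof (rule trial_0_eq_0D[OF _ ind])
  have L2: "L2_fun a b \<phi>1" "L2_fun a b \<phi>2" and ac: "has_ac_derivative a b \<phi>1 d\<phi>1" "has_ac_derivative a b \<phi>2 d\<phi>2"
    using H1 unfolding has_H1_derivative_def by blast+
  let ?f = "\<lambda>z. trial v (\<phi>1 z) (\<phi>2 z) :: real ^ ('n1 + 'n2)"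
  have "continuous_on {a..b} ?f"
    by (rule has_ac_derivative_imp_continuous_on[OF has_ac_derivative_trial[OF ac]])
  then have "continuous_on {a..b} (\<lambda>z. ?f z \<bullet> ?f z)"
    by (intro continuous_intros)
  moreover have "(LINT z|lebesgue_on {a..b}. ?f z \<bullet> ?f z) = 0"
    using inner_gram[OF L2 L2, of "\<lambda>_. mat 1" v v] Ev unfolding E_mat_eq_gram[OF L2] by simp
  ultimately have "\<forall>z\<in>{a..b}. ?f z \<bullet> ?f z = 0"
    using integralL_eq_0_iff[of a b "\<lambda>z. ?f z \<bullet> ?f z"] \<open>a < b\<close> by simp
  then show "?f z = 0" if "z \<in> {a..b}" for z
    using that by simp
qed

section \<open>Boundary traces and the power balance of the discretized model\<close>

lemma vec_mult_Omega_ba: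
  "v v* Omega_ba a b \<phi>1 \<phi>2 = vcat (trial v (\<phi>1 b) (\<phi>2 b)) (trial v (\<phi>1 a) (\<phi>2 a))"
  by (simp add: Omega_ba_def vec_mult_hcat trial_def Theta_def)

text \<open>The supplied power is a quadratic form in the traces, so it sees only the symmetric part
  of \<open>transpose VC ** VB\<close>, which the assumption prescribes; the skew part drops
  out.\<close>

lemma two_port_power:
  assumes "transpose VC ** VB + transpose VB ** VC = block_mat P 0 0 (- P)"
  shows "2 * ((VB *v vcat p q) \<bullet> (VC *v vcat p q)) = p \<bullet> (P *v p) - q \<bullet> (P *v q)"
proof -
  let ?w = "vcat p q"
  have "2 * ((VB *v ?w) \<bullet> (VC *v ?w)) = ?w \<bullet> (transpose VC *v (VB *v ?w)) + ?w \<bullet> (transpose VB *v (VC *v ?w))"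
    by (simp add: inner_transpose_mat inner_commute del: transpose_matrix_vector)
  also have "\<dots> = ?w \<bullet> (block_mat P 0 0 (- P) *v ?w)"
    by (simp only: assms[symmetric] matrix_vector_mult_add_rdistrib inner_add_right matrix_vector_mul_assoc)
  also have "\<dots> = p \<bullet> (P *v p) - q \<bullet> (P *v q)"
    by (simp add: block_diag_mult_vec inner_vcat matrix_vector_mult_diff_rdistrib[of 0 P, simplified])
  finally show ?thesis .
qed

lemma discrete_power_balance:
  fixes v :: "real ^ (('n1::finite \<times> 'N1::finite) + ('n2::finite \<times> 'N2::finite))"
    and P G :: "real ^ ('n1 + 'n2) ^ ('n1 + 'n2)"
  assumes "a < b" and P: "symmetric_mat P"
    and V: "transpose VC ** VB + transpose VB ** VC = block_mat P 0 0 (- P)"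
    and H1: "has_H1_derivative a b \<phi>1 d\<phi>1" "has_H1_derivative a b \<phi>2 d\<phi>2"
  shows "v \<bullet> ((J_mat a b P G VB VC \<phi>1 \<phi>2 d\<phi>1 d\<phi>2 - R_mat a b G \<phi>1 \<phi>2) *v v + B_mat a b VC \<phi>1 \<phi>2 *v u)
    = u \<bullet> (transpose (B_mat a b VC \<phi>1 \<phi>2) *v v)
      - (LINT z|lebesgue_on {a..b}. trial v (\<phi>1 z) (\<phi>2 z) \<bullet> (G *v trial v (\<phi>1 z) (\<phi>2 z)))"
proof -
  have L2: "L2_fun a b \<phi>1" "L2_fun a b \<phi>2" "L2_fun a b d\<phi>1" "L2_fun a b d\<phi>2"
    and ac: "has_ac_derivative a b \<phi>1 d\<phi>1" "has_ac_derivative a b \<phi>2 d\<phi>2"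
    using H1 unfolding has_H1_derivative_def by blast+
  let ?f = "\<lambda>z. trial v (\<phi>1 z) (\<phi>2 z) :: real ^ ('n1 + 'n2)"
  let ?f' = "\<lambda>z. trial v (d\<phi>1 z) (d\<phi>2 z) :: real ^ ('n1 + 'n2)"
  let ?w = "v v* Omega_ba a b \<phi>1 \<phi>2 :: real ^ (('n1 + 'n2) + ('n1 + 'n2))"
  let ?DG = "D_mat a b G \<phi>1 \<phi>2 \<phi>1 \<phi>2 :: real ^ (('n1 \<times> 'N1) + ('n2 \<times> 'N2)) ^ (('n1 \<times> 'N1) + ('n2 \<times> 'N2))"
  \<comment> \<open>The boundary term left by partial integration is rewritten as the port power of
    the traces, to cancel the \<open>Omega_ba\<close> term of \<open>J_mat\<close>.\<close>
  have "2 * (v \<bullet> (D_mat a b P \<phi>1 \<phi>2 d\<phi>1 d\<phi>2 *v v)) = 2 * (LINT z|lebesgue_on {a..b}. ?f z \<bullet> (P *v ?f' z))"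
    by (simp add: D_mat_eq_gram[OF L2] inner_gram[OF L2])
  also have "\<dots> = ?f b \<bullet> (P *v ?f b) - ?f a \<bullet> (P *v ?f a)"
    using \<open>a < b\<close> by (intro ac_inner_symmetric_by_parts P has_ac_derivative_trial ac L2_fun_trial L2) auto
  also have "\<dots> = 2 * ((VB *v ?w) \<bullet> (VC *v ?w))"
    by (simp add: vec_mult_Omega_ba two_port_power[OF V])
  finally have D: "v \<bullet> (D_mat a b P \<phi>1 \<phi>2 d\<phi>1 d\<phi>2 *v v) = (VB *v ?w) \<bullet> (VC *v ?w)" by simp
  have O: "v \<bullet> ((Omega_ba a b \<phi>1 \<phi>2 ** transpose VC ** VB ** transpose (Omega_ba a b \<phi>1 \<phi>2)) *v v) =
      (VB *v ?w) \<bullet> (VC *v ?w)"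
  proof -
    have "?w \<bullet> (transpose VC *v (VB *v ?w)) = (VB *v ?w) \<bullet> (VC *v ?w)"
      by (rule inner_transpose_mat)
    then show ?thesis
      by (simp add: dot_lmul_matrix flip: matrix_vector_mul_assoc)
  qed
  have G: "v \<bullet> (?DG *v v) = (LINT z|lebesgue_on {a..b}. ?f z \<bullet> (G *v ?f z))"
    by (simp add: D_mat_eq_gram[OF L2(1,2,1,2)] inner_gram[OF L2(1,2,1,2)])
  \<comment> \<open>Hence the skew part of \<open>D\<^sup>G\<close> drops out of the form of
    \<open>J\<close>, and \<open>R\<close> has the same form as \<open>D\<^sup>G\<close>.\<close>
  have GT: "v \<bullet> (transpose ?DG *v v) = v \<bullet> (?DG *v v)"
    by (rule inner_transpose_mat)
  have "v \<bullet> (J_mat a b P G VB VC \<phi>1 \<phi>2 d\<phi>1 d\<phi>2 *v v) = 0"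
    using GT D O
    by (simp add: J_mat_def matrix_vector_mult_diff_rdistrib scaleR_matrix_vector_assoc[symmetric] inner_diff_right
        del: transpose_matrix_vector)
  moreover have "v \<bullet> (R_mat a b G \<phi>1 \<phi>2 *v v) = v \<bullet> (?DG *v v)"
    using GT by (simp add: R_mat_def matrix_vector_mult_add_rdistrib scaleR_matrix_vector_assoc[symmetric] inner_add_right
        del: transpose_matrix_vector)
  moreover have "v \<bullet> (B_mat a b VC \<phi>1 \<phi>2 *v u) = u \<bullet> (transpose (B_mat a b VC \<phi>1 \<phi>2) *v v)"
    by (rule inner_transpose_mat[symmetric])
  ultimately show ?thesis
    by (simp add: G matrix_vector_mult_diff_rdistrib inner_diff_right inner_add_right del: transpose_matrix_vector)
qed

subsection \<open>Stationary solutions of the BC-PHS\<close>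

text \<open>The solution is the matrix exponential exp((z - a) A) v, built in each component as a
  power series with coefficients (A^k v)_i / k!.\<close>

lemma linear_ode_solution:
  fixes A :: "real ^ 'n ^ 'n"
  obtains \<epsilon> where "\<epsilon> a = v" "\<And>z. (\<epsilon> has_vector_derivative A *v \<epsilon> z) (at z)"
proof -
  obtain K where K: "\<And>x. norm (A *v x) \<le> norm x * K" "0 < K"
    using bounded_linear.pos_bounded[OF matrix_vector_mul_bounded_linear[of A]] by blast
  define p where "p k = ((*v) A ^^ k) v" for k
  define c where "c i k = p k $ i / fact k" for i k
  have p_Suc: "p (Suc k) = A *v p k" for k by (simp add: p_def)
  \<comment> \<open>Geometric growth of \<open>p\<close> makes the exponential series of
    \<open>K * \<bar>z\<bar>\<close> a majorant, so the component series converge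
    everywhere.\<close>
  have p_le: "norm (p k) \<le> norm v * K ^ k" for k
  proof (induction k)
    case (Suc k)
    have "norm (p (Suc k)) \<le> norm (p k) * K" unfolding p_Suc by (rule K)
    also have "\<dots> \<le> norm v * K ^ k * K" using Suc K(2) by (intro mult_right_mono) auto
    finally show ?case by (simp add: mult_ac)
  qed (simp add: p_def)
  have summable: "summable (\<lambda>k. c i k * z ^ k)" for i z
  proof (rule summable_comparison_test')
    show "summable (\<lambda>k. norm v * ((K * \<bar>z\<bar>) ^ k /\<^sub>R fact k))"
      by (intro summable_mult summable_exp_generic)
    fix k :: nat
    have "\<bar>p k $ i\<bar> \<le> norm v * K ^ k"
      using component_le_norm_cart[of "p k" i] p_le[of k] by linarith
    then have "\<bar>p k $ i\<bar> * \<bar>z\<bar> ^ k / fact k \<le> norm v * K ^ k * \<bar>z\<bar> ^ k / fact k"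
      by (intro divide_right_mono mult_right_mono) auto
    then show "norm (c i k * z ^ k) \<le> norm v * ((K * \<bar>z\<bar>) ^ k /\<^sub>R fact k)"
      by (simp add: c_def abs_mult power_abs power_mult_distrib divide_inverse mult_ac)
  qed
  define y where "y z = (\<chi> i. \<Sum>k. c i k * z ^ k)" for z
  have y': "(y has_vector_derivative A *v y z) (at z)" for z
  proof -
    have comp: "((\<lambda>z. y z $ i) has_vector_derivative (A *v y z) $ i) (at z)" for i
    proof -
      \<comment> \<open>Termwise differentiation cancels one factor of the factorial and shifts
        \<open>p k\<close> to \<open>p (Suc k) = A *v p k\<close>.\<close>
      have "diffs (c i) k * z ^ k = (\<Sum>j\<in>UNIV. A $ i $ j * (c j k * z ^ k))" for k
      proof -
        have "diffs (c i) k = p (Suc k) $ i / fact k"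
          by (simp add: diffs_def c_def field_simps del: of_nat_Suc)
        also have "\<dots> = (\<Sum>j\<in>UNIV. A $ i $ j * c j k)"
          by (simp add: p_Suc matrix_vector_mult_def c_def sum_divide_distrib)
        finally show ?thesis by (simp add: sum_distrib_left mult_ac)
      qed
      then have "(\<Sum>k. diffs (c i) k * z ^ k) = (\<Sum>k. \<Sum>j\<in>UNIV. A $ i $ j * (c j k * z ^ k))"
        by simp
      also have "\<dots> = (\<Sum>j\<in>UNIV. \<Sum>k. A $ i $ j * (c j k * z ^ k))"
        by (intro suminf_sum summable_mult summable)
      also have "\<dots> = (\<Sum>j\<in>UNIV. A $ i $ j * (\<Sum>k. c j k * z ^ k))"
        by (intro sum.cong refl suminf_mult summable)
      finally have eq: "(\<Sum>k. diffs (c i) k * z ^ k) = (A *v y z) $ i"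
        by (simp add: y_def matrix_vector_mult_def)
      show ?thesis
        using termdiffs_strong_converges_everywhere[of "c i" z, OF summable]
        unfolding eq by (simp add: y_def has_real_derivative_iff_has_vector_derivative)
    qed
    then show ?thesis
      unfolding has_vector_derivative_def
      by (subst has_derivative_componentwise_within) (auto simp: Basis_vec_def inner_axis)
  qed
  have y0: "y 0 = v"
    by (simp add: y_def vec_eq_iff powser_zero) (simp add: c_def p_def)
  show thesis
  proof (rule that[of "\<lambda>z. y (z - a)"])
    show "y (a - a) = v" by (simp add: y0)
    fix z
    have "((y \<circ> (\<lambda>z. z - a)) has_vector_derivative 1 *\<^sub>R (A *v y (z - a))) (at z)"
      by (rule vector_diff_chain_at) (auto intro!: derivative_eq_intros y')
    then show "((\<lambda>z. y (z - a)) has_vector_derivative A *v y (z - a)) (at z)"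
      by (simp add: o_def)
  qed
qed

lemma mult_matrix_inv:
  assumes "invertible A"
  shows "A ** matrix_inv A = mat 1" "matrix_inv A ** A = mat 1"
  using someI_ex[OF assms[unfolded invertible_def]] by (simp_all add: matrix_inv_def)

lemma invertible_injective:
  fixes A :: "real ^ 'n ^ 'n"
  assumes "\<And>v. A *v v = 0 \<Longrightarrow> v = 0"
  shows "invertible A"
  using assms by (simp add: invertible_left_inverse matrix_left_invertible_ker)

lemma invertible_pos_def_mat:
  assumes "pos_def_mat A"
  shows "invertible A"
  using assms unfolding pos_def_mat_def by (metis inner_zero_right invertible_injective less_irrefl)

lemma L2_norm_zero [simp]: "L2_norm a b (\<lambda>z. 0) = 0"
  by (simp add: L2_norm_def)

text \<open>Since P \<epsilon>' = G \<epsilon>, the right-hand side of the PDE vanishes, and the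
  state with effort \<open>\<epsilon>\<close> can stay constant in time.\<close>

lemma stationary_bcphs_solution:
  fixes P G :: "real ^ 'n ^ 'n"
  assumes P: "invertible P" and H: "continuous_on {a..b} H"
    and pd: "\<And>z. z \<in> {a..b} \<Longrightarrow> pos_def_mat (H z)"
    and \<epsilon>: "\<And>z. (\<epsilon> has_vector_derivative (matrix_inv P ** G) *v \<epsilon> z) (at z)"
  shows "\<exists>x. bcphs_solution a b P G H (\<lambda>t. x) (\<lambda>t. \<epsilon>)"
proof -
  define \<epsilon>' where "\<epsilon>' z = (matrix_inv P ** G) *v \<epsilon> z" for z
  \<comment> \<open>Cramer's rule for \<open>H z *v x z = \<epsilon> z\<close>: the quotient of
    determinants makes continuity of \<open>x\<close> visible from that of the entries.\<close>
  define x where "x z = (\<chi> k. det (\<chi> i j. if j = k then \<epsilon> z $ i else H z $ i $ j) / det (H z))" for z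
  have cont: "continuous_on S \<epsilon>" for S
    by (intro continuous_at_imp_continuous_on ballI has_vector_derivative_continuous[OF \<epsilon>])
  then have cont': "continuous_on S \<epsilon>'" for S
    unfolding \<epsilon>'_def by (intro bounded_linear.continuous_on[OF matrix_vector_mul_bounded_linear])
  have within: "(\<epsilon> has_vector_derivative \<epsilon>' z) (at z within S)" for z S
    unfolding \<epsilon>'_def by (rule has_vector_derivative_at_within[OF \<epsilon>])
  have det0: "det (H z) \<noteq> 0" if "z \<in> {a..b}" for z
    using invertible_pos_def_mat[OF pd[OF that]] by (simp add: invertible_det_nz)
  have Hx: "H z *v x z = \<epsilon> z" if "z \<in> {a..b}" for z
    using cramer[OF det0[OF that]] by (simp add: x_def)
  have det_cont: "continuous_on {a..b} (\<lambda>z. det (M z))"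
    if "\<And>i j. continuous_on {a..b} (\<lambda>z. M z $ i $ j)" for M :: "real \<Rightarrow> real ^ 'n ^ 'n"
    unfolding det_def by (intro continuous_intros that)
  have "continuous_on {a..b} (\<lambda>z. if j = k then \<epsilon> z $ i else H z $ i $ j)" for i j k
    using cont H by (cases "j = k") (auto intro: continuous_intros)
  then have "continuous_on {a..b} (\<lambda>z. det (\<chi> i j. if j = k then \<epsilon> z $ i else H z $ i $ j))" for k
    by (intro det_cont) simp
  moreover have "continuous_on {a..b} (\<lambda>z. det (H z))"
    by (intro det_cont continuous_on_component H)
  ultimately have "continuous_on {a..b} x"
    unfolding x_def using det0 by (intro continuous_on_vec_lambda continuous_on_divide) auto
  then have L2: "L2_fun a b x" "L2_fun a b \<epsilon>" "L2_fun a b \<epsilon>'"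
    using cont[of "{a..b}"] cont'[of "{a..b}"] by (simp_all add: continuous_imp_L2_fun)
  have ac: "has_ac_derivative a b \<epsilon> \<epsilon>'"
    unfolding has_ac_derivative_def
  proof (intro conjI ballI)
    show "integrable (lebesgue_on {a..b}) \<epsilon>'"
      by (intro continuous_imp_integrable_real cont')
    show "AE z in lebesgue_on {a..b}. (\<epsilon> has_vector_derivative \<epsilon>' z) (at z within {a..b})"
      by (intro AE_I2 within)
    fix z assume "z \<in> {a..b}"
    then have "(\<epsilon>' has_integral \<epsilon> z - \<epsilon> a) {a..z}"
      by (intro fundamental_theorem_of_calculus within) auto
    moreover have "(LINT s|lebesgue_on {a..z}. \<epsilon>' s) = integral {a..z} \<epsilon>'"
      by (intro lebesgue_integral_eq_integral continuous_imp_integrable_real cont') auto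
    ultimately show "\<epsilon> z = \<epsilon> a + (LINT s|lebesgue_on {a..z}. \<epsilon>' s)"
      by (simp add: integral_unique)
  qed
  show ?thesis
    unfolding bcphs_solution_def
  proof (rule exI[of _ x], rule exI[of _ "\<lambda>t z. 0"], rule exI[of _ "\<lambda>t. \<epsilon>'"], intro conjI)
    have "P *v \<epsilon>' z = G *v \<epsilon> z" for z
      using mult_matrix_inv(1)[OF P] by (simp add: \<epsilon>'_def matrix_vector_mul_assoc matrix_mul_assoc)
    then show "\<forall>t\<ge>0. AE z in lebesgue_on {a..b}. 0 = P *v \<epsilon>' z - G *v \<epsilon> z" by simp
    show "\<forall>t\<ge>0. AE z in lebesgue_on {a..b}. \<epsilon> z = H z *v x z" using Hx by auto
    have "L2_fun a b (\<lambda>z. 0 :: real ^ 'n)" by (rule continuous_imp_L2_fun[OF continuous_on_const])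
    then show "L2_has_C1_derivative a b (\<lambda>t. x) (\<lambda>t z. 0)"
      using L2 by (simp add: L2_has_C1_derivative_def L2_continuous_def)
  qed (use ac L2 in \<open>simp_all add: has_H1_derivative_def L2_continuous_def\<close>)
qed

text \<open>The Hamiltonian of a stationary solution is constant, so IEP forces zero port power,
  that is F(b) = F(a) for F = \<epsilon> . P \<epsilon>. As F' = 2 \<epsilon> . G \<epsilon> >= 0, F
  is constant on the interval, and its derivative at \<open>a\<close>, where
  \<open>\<epsilon>\<close> equals \<open>v\<close>, is 0.\<close>

lemma bcphs_IEP_imp_lossless:
  fixes P G :: "real ^ 'n ^ 'n"
  assumes "a < b" and sym: "symmetric_mat P" and inv: "invertible P"
    and pos: "\<And>v. 0 \<le> v \<bullet> (G *v v)"
    and H: "continuous_on {a..b} H" and pd: "\<And>z. z \<in> {a..b} \<Longrightarrow> pos_def_mat (H z)"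
    and V: "transpose VC ** VB + transpose VB ** VC = block_mat P 0 0 (- P)"
    and IEP: "bcphs_IEP a b P G H VB VC"
  shows "v \<bullet> (G *v v) = 0"
proof -
  obtain \<epsilon> where \<epsilon>a: "\<epsilon> a = v"
    and \<epsilon>: "\<And>z. (\<epsilon> has_vector_derivative (matrix_inv P ** G) *v \<epsilon> z) (at z)"
    using linear_ode_solution[of a v "matrix_inv P ** G"] by blast
  obtain x where "bcphs_solution a b P G H (\<lambda>t. x) (\<lambda>t. \<epsilon>)"
    using stationary_bcphs_solution[OF inv H pd \<epsilon>] by blast
  then have "((\<lambda>s. hamiltonian a b H x) has_real_derivative
      bcphs_port a b VB (\<lambda>t. \<epsilon>) 1 \<bullet> bcphs_port a b VC (\<lambda>t. \<epsilon>) 1) (at 1 within {0..})"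
    using IEP unfolding bcphs_IEP_def by (meson zero_le_one)
  \<comment> \<open>Time 1 is an arbitrary interior time; there the derivative within the half-line
    is two-sided, hence unique.\<close>
  moreover have "at (1::real) within {0..} = at 1"
    by (rule at_within_interior) simp
  ultimately have port: "bcphs_port a b VB (\<lambda>t. \<epsilon>) 1 \<bullet> bcphs_port a b VC (\<lambda>t. \<epsilon>) 1 = 0"
    using DERIV_unique[OF _ DERIV_const] by metis
  define F where "F z = \<epsilon> z \<bullet> (P *v \<epsilon> z)" for z
  have Fba: "F b = F a"
    using port two_port_power[OF V, of "\<epsilon> b" "\<epsilon> a"] by (simp add: F_def bcphs_port_def)
  have F': "(F has_real_derivative 2 * (\<epsilon> z \<bullet> (G *v \<epsilon> z))) (at z)" for z
  proof -
    let ?\<epsilon>' = "(matrix_inv P ** G) *v \<epsilon> z"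
    have "((\<lambda>z. P *v \<epsilon> z) has_vector_derivative P *v ?\<epsilon>') (at z)"
      by (intro bounded_linear.has_vector_derivative[OF matrix_vector_mul_bounded_linear] \<epsilon>)
    then have "(F has_vector_derivative (\<epsilon> z \<bullet> (P *v ?\<epsilon>') + ?\<epsilon>' \<bullet> (P *v \<epsilon> z))) (at z)"
      unfolding F_def by (intro bounded_bilinear.has_vector_derivative[OF bounded_bilinear_inner] \<epsilon>)
    moreover have "?\<epsilon>' \<bullet> (P *v \<epsilon> z) = \<epsilon> z \<bullet> (P *v ?\<epsilon>')"
      by (rule inner_symmetric_mat[OF sym])
    moreover have "P *v ?\<epsilon>' = G *v \<epsilon> z"
      using mult_matrix_inv(1)[OF inv] by (simp add: matrix_vector_mul_assoc matrix_mul_assoc)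
    ultimately show ?thesis
      by (simp add: has_real_derivative_iff_has_vector_derivative)
  qed
  have mono: "F s \<le> F t" if "s \<le> t" for s t
    by (rule DERIV_nonneg_imp_nondecreasing[OF that], rule exI, rule conjI, rule F') (simp add: pos)
  have const: "F z = F a" if "z \<in> {a..b}" for z
    using mono[of a z] mono[of z b] Fba that by auto
  \<comment> \<open>Constancy is known only on the interval, so the derivatives at \<open>a\<close>
    are compared one-sidedly.\<close>
  have "(F has_vector_derivative 0) (at a within {a..b})"
  proof (rule has_vector_derivative_transform)
    show "F z = F a" if "z \<in> {a..b}" for z by (rule const[OF that])
  qed (use \<open>a < b\<close> in simp_all)
  moreover have "(F has_vector_derivative 2 * (\<epsilon> a \<bullet> (G *v \<epsilon> a))) (at a within {a..b})"
    using F'[of a] by (simp add: has_real_derivative_iff_has_vector_derivative has_vector_derivative_at_within)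
  ultimately have "0 = 2 * (\<epsilon> a \<bullet> (G *v \<epsilon> a))"
    using vector_derivative_unique_within_closed_interval[of a b a F] \<open>a < b\<close> by fastforce
  then show ?thesis by (simp add: \<epsilon>a)
qed

subsection \<open>Caratheodory solutions and the power balance\<close>

lemma AE_lebesgue_neq: "AE t in lebesgue. t \<noteq> (c :: real)"
  using AE_completion[OF AE_lborel_singleton[of c]] .

text \<open>Absolute continuity yields derivatives within compact intervals only. Countably many
  such intervals exhaust the positive half-line, and each t > 0 is interior to one of them; the time
  0 is a null set.\<close>

lemma AE_derivative_half_line:
  fixes x :: "real \<Rightarrow> 'v::euclidean_space"
  assumes ac: "\<And>s t. 0 < s \<Longrightarrow> s < t \<Longrightarrow> has_ac_derivative s t x dx"
  shows "AE t in lebesgue_on {0..}. (x has_vector_derivative dx t) (at t within {0..})"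
proof -
  \<comment> \<open>The right end is at least 2 and the left end at most 1, so no interval is
    degenerate. The intervals increase with \<open>n\<close>.\<close>
  define I where "I n = {inverse (real (Suc n))..real n + 2}" for n
  have "AE t in lebesgue. t \<in> I n \<longrightarrow> (x has_vector_derivative dx t) (at t within I n)" for n
  proof -
    have "inverse (real (Suc n)) \<le> 1" by (simp add: field_simps)
    then have "has_ac_derivative (inverse (real (Suc n))) (real n + 2) x dx"
      by (intro ac) auto
    then have "AE t in lebesgue_on (I n). (x has_vector_derivative dx t) (at t within I n)"
      unfolding has_ac_derivative_def I_def by blast
    then show ?thesis
      by (subst (asm) AE_restrict_space_iff) (auto simp: I_def)
  qed
  then have "AE t in lebesgue. \<forall>n. t \<in> I n \<longrightarrow> (x has_vector_derivative dx t) (at t within I n)"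
    by (simp add: AE_all_countable)
  with AE_lebesgue_neq[of 0]
  have "AE t in lebesgue. t \<in> {0..} \<longrightarrow> (x has_vector_derivative dx t) (at t within {0..})"
  proof eventually_elim
    case (elim t)
    show ?case
    proof
      assume "t \<in> {0..}"
      then have "0 < t" using elim(1) by simp
      obtain m where m: "inverse (real (Suc m)) < t" using reals_Archimedean[OF \<open>0 < t\<close>] by blast
      obtain k where k: "t < real k" using reals_Archimedean2 by blast
      define n where "n = max m k"
      have "inverse (real (Suc n)) \<le> inverse (real (Suc m))" "real k \<le> real n"
        by (auto simp: n_def intro: le_imp_inverse_le)
      then have t: "t \<in> interior (I n)"
        using m k unfolding I_def interior_atLeastAtMost_real greaterThanLessThan_iff by linarith
      then have "at t within I n = at t"
        by (rule at_within_interior)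
      moreover have "at t within {0..} = at t"
        using \<open>0 < t\<close> by (intro at_within_interior) simp
      ultimately show "(x has_vector_derivative dx t) (at t within {0..})"
        using elim(2) t interior_subset by (metis subsetD)
    qed
  qed
  then show ?thesis
    by (subst AE_restrict_space_iff) auto
qed

text \<open>The difference \<open>y\<close> of \<open>x\<close> and the integral of \<open>g\<close>
  is constant, so \<open>x\<close> inherits the derivative of an integral with continuous
  integrand.\<close>

lemma caratheodory_imp_classical:
  fixes x :: "real \<Rightarrow> 'v::euclidean_space"
  assumes x: "continuous_on {0..} x" and g: "continuous_on {0..} g"
    and ac: "\<And>s t. 0 < s \<Longrightarrow> s < t \<Longrightarrow> has_ac_derivative s t x dx"
    and ae: "AE t in lebesgue_on {0..}. dx t = g t"
    and "0 \<le> t"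
  shows "(x has_vector_derivative g t) (at t within {0..})"
proof -
  have g_on: "continuous_on {s..r} g" if "0 \<le> s" for s r
    using that by (intro continuous_on_subset[OF g]) auto
  have diff: "x r - x s = integral {s..r} g" if sr: "0 < s" "s < r" for s r
  proof -
    have gi: "integrable (lebesgue_on {s..r}) g"
      using sr by (intro continuous_imp_integrable_real g_on) auto
    have di: "integrable (lebesgue_on {s..r}) dx"
      using ac[OF sr] unfolding has_ac_derivative_def by blast
    have "AE t in lebesgue. t \<in> {0..} \<longrightarrow> dx t = g t"
      using ae by (subst (asm) AE_restrict_space_iff) auto
    then have "AE t in lebesgue. t \<in> {s..r} \<longrightarrow> dx t = g t"
      by eventually_elim (use sr in auto)
    then have "AE t in lebesgue_on {s..r}. dx t = g t"
      by (subst AE_restrict_space_iff) auto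
    then have "(LINT t|lebesgue_on {s..r}. dx t) = (LINT t|lebesgue_on {s..r}. g t)"
      using di gi by (intro integral_cong_AE) auto
    moreover have "x r = x s + (LINT t|lebesgue_on {s..r}. dx t)"
      using ac[OF sr] sr unfolding has_ac_derivative_def by (meson atLeastAtMost_iff less_imp_le order_refl)
    ultimately show ?thesis
      using gi by (simp add: lebesgue_integral_eq_integral)
  qed
  \<comment> \<open>Any end beyond \<open>t\<close> serves: near \<open>t\<close> the interval up to
    \<open>T\<close> then agrees with the half-line.\<close>
  define T where "T = t + 1"
  define y where "y r = x r - integral {0..r} g" for r
  have "0 < T" "t < T" using \<open>0 \<le> t\<close> by (auto simp: T_def)
  have int: "g integrable_on {0..r}" for r
    by (intro integrable_continuous_real g_on) simp
  have "y r = y s" if "0 < s" "s < r" for s r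
    using diff[OF that] Henstock_Kurzweil_Integration.integral_combine[of 0 s r g] int[of r] that
    by (simp add: y_def algebra_simps)
  then have const: "y r = y (T/2)" if "r \<in> {0<..<T}" for r
    using that \<open>0 < T\<close> by (cases r "T/2" rule: linorder_cases) auto
  \<comment> \<open>The increments of \<open>x\<close> are controlled only at positive times;
    continuity at 0 extends the constancy of \<open>y\<close> to the closed interval.\<close>
  have "continuous_on {0..T} y"
    unfolding y_def
    by (intro continuous_on_diff continuous_on_subset[OF x] indefinite_integral_continuous_1 int) auto
  then have cont: "continuous_on (closure {0<..<T}) y"
    using \<open>0 < T\<close> by simp
  have y: "y r = y (T/2)" if "r \<in> {0..T}" for r
    by (rule continuous_constant_on_closure[OF cont]) (use that \<open>0 < T\<close> const in \<open>simp_all only: closure_greaterThanLessThan\<close>)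
  have "((\<lambda>r. y (T/2) + integral {0..r} g) has_vector_derivative g t) (at t within {0..T})"
    using integral_has_vector_derivative[OF g_on, of 0 t T] \<open>0 \<le> t\<close> \<open>t < T\<close>
    by (auto intro!: derivative_eq_intros)
  then have "(x has_vector_derivative g t) (at t within {0..T})"
  proof (rule has_vector_derivative_transform[rotated 2])
    show "x r = y (T/2) + integral {0..r} g" if "r \<in> {0..T}" for r
      using y[OF that] unfolding y_def by (simp add: algebra_simps)
  qed (use \<open>0 \<le> t\<close> \<open>t < T\<close> in auto)
  moreover have "at t within {0..T} = at t within {0..}"
    using \<open>t < T\<close> by (intro at_within_nhd[of _ "{..<T}"]) auto
  ultimately show ?thesis by simp
qed

text \<open>Symmetry of \<open>Q\<close> gives the rate d . Q x; with \<open>Q x = E e\<close> and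
  symmetry of \<open>E\<close> it becomes e . E d, which the state equation determines.\<close>

lemma discrete_energy_derivative:
  assumes x: "(x has_vector_derivative d) (at t within S)"
    and Q: "\<And>v w. v \<bullet> (Q *v w) = w \<bullet> (Q *v v)" and E: "\<And>v w. v \<bullet> (E *v w) = w \<bullet> (E *v v)"
    and e: "E *v e = Q *v x t"
  shows "((\<lambda>s. discrete_energy Q (x s)) has_real_derivative e \<bullet> (E *v d)) (at t within S)"
proof -
  have "((\<lambda>s. Q *v x s) has_vector_derivative Q *v d) (at t within S)"
    by (rule bounded_linear.has_vector_derivative[OF matrix_vector_mul_bounded_linear x])
  from bounded_bilinear.has_vector_derivative[OF bounded_bilinear_inner x this]
  have "((\<lambda>s. x s \<bullet> (Q *v x s)) has_real_derivative x t \<bullet> (Q *v d) + d \<bullet> (Q *v x t)) (at t within S)"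
    by (simp add: has_real_derivative_iff_has_vector_derivative)
  from DERIV_cmult[OF this, of "1/2"]
  have "((\<lambda>s. discrete_energy Q (x s)) has_real_derivative d \<bullet> (Q *v x t)) (at t within S)"
    by (simp add: discrete_energy_def Q[of "x t" d])
  then show ?thesis by (simp add: E[of e d] e)
qed

text \<open>The dissipation \<open>\<delta>\<close> is kept abstract so that one exact balance
  serves both claims: passivity for \<open>\<delta>\<close> nonnegative, IEP for
  \<open>\<delta>\<close> zero.\<close>

lemma discrete_system_power_balance:
  assumes Q: "\<And>v w. v \<bullet> (Q *v w) = w \<bullet> (Q *v v)" and E: "\<And>v w. v \<bullet> (E *v w) = w \<bullet> (E *v v)"
    and inv: "invertible E"
    and bal: "\<And>v u. v \<bullet> ((J - R) *v v + B *v u) = u \<bullet> (transpose B *v v) - \<delta> v"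
    and sys: "discrete_system E Q J R B u x y"
  obtains e where
    "AE t in lebesgue_on {0..}.
       ((\<lambda>s. discrete_energy Q (x s)) has_real_derivative u t \<bullet> y t - \<delta> (e t)) (at t within {0..})"
    "\<And>t. continuous_on {0..} u \<Longrightarrow> 0 \<le> t \<Longrightarrow>
       ((\<lambda>s. discrete_energy Q (x s)) has_real_derivative u t \<bullet> y t - \<delta> (e t)) (at t within {0..})"
proof -
  from sys obtain e dx where x: "continuous_on {0..} x"
    and ac': "\<forall>s t. 0 < s \<and> s < t \<longrightarrow> has_ac_derivative s t x dx"
    and ode: "AE t in lebesgue_on {0..}. E *v dx t = (J - R) *v e t + B *v u t"
    and e': "\<forall>t\<ge>0. E *v e t = Q *v x t" and y': "\<forall>t\<ge>0. y t = transpose B *v e t"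
    unfolding discrete_system_def by (elim conjE exE) (rule that)
  have ac: "has_ac_derivative s t x dx" if "0 < s" "s < t" for s t
    using ac' that by blast
  have e: "E *v e t = Q *v x t" and y: "y t = transpose B *v e t" if "0 \<le> t" for t
    using e' y' that by blast+
  \<comment> \<open>Used with \<open>d = dx t\<close> for almost every time and with
    \<open>d = g t\<close> at every time for continuous inputs.\<close>
  have rate: "((\<lambda>s. discrete_energy Q (x s)) has_real_derivative u t \<bullet> y t - \<delta> (e t)) (at t within {0..})"
    if "0 \<le> t" "(x has_vector_derivative d) (at t within {0..})" "E *v d = (J - R) *v e t + B *v u t" for t d
    using discrete_energy_derivative[OF that(2) Q E e[OF that(1)]] that(3) bal[of "e t" "u t"] y[OF that(1)]
    by simp
  have "AE t in lebesgue_on {0..}. (x has_vector_derivative dx t) (at t within {0..})"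
    by (rule AE_derivative_half_line) (rule ac)
  moreover have "AE t in lebesgue_on {0..}. t \<in> space (lebesgue_on {0..})"
    by (rule AE_space)
  ultimately
  have ae: "AE t in lebesgue_on {0..}.
      ((\<lambda>s. discrete_energy Q (x s)) has_real_derivative u t \<bullet> y t - \<delta> (e t)) (at t within {0..})"
    using ode by eventually_elim (rule rate, auto)
  have cont: "((\<lambda>s. discrete_energy Q (x s)) has_real_derivative u t \<bullet> y t - \<delta> (e t)) (at t within {0..})"
    if u: "continuous_on {0..} u" and "0 \<le> t" for t
  proof -
    have E_inv: "matrix_inv E *v (E *v v) = v" for v
      by (simp add: matrix_vector_mul_assoc mult_matrix_inv[OF inv])
    \<comment> \<open>The state equation solved for the derivative, with \<open>e\<close>
      eliminated, so that continuity follows from that of \<open>x\<close> and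
      \<open>u\<close>.\<close>
    define g where
      "g t = matrix_inv E *v ((J - R) *v (matrix_inv E *v (Q *v x t)) + B *v u t)" for t
    have g: "continuous_on {0..} g"
      unfolding g_def
      by (intro bounded_linear.continuous_on[OF matrix_vector_mul_bounded_linear] continuous_on_add x u)
    have g_eq: "g t = matrix_inv E *v ((J - R) *v e t + B *v u t)" if "0 \<le> t" for t
      by (simp add: g_def E_inv flip: e[OF that])
    have "AE t in lebesgue_on {0..}. t \<in> space (lebesgue_on {0..})"
      by (rule AE_space)
    with ode have "AE t in lebesgue_on {0..}. dx t = g t"
    proof eventually_elim
      case (elim t)
      then show ?case
        using E_inv[of "dx t"] by (simp add: g_eq)
    qed
    then have "(x has_vector_derivative g t) (at t within {0..})"
      using ac \<open>0 \<le> t\<close> by (intro caratheodory_imp_classical[OF x g])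
    then show ?thesis
      by (rule rate[OF \<open>0 \<le> t\<close>]) (simp add: g_eq[OF \<open>0 \<le> t\<close>] matrix_vector_mul_assoc mult_matrix_inv[OF inv])
  qed
  show thesis
    by (rule that[OF ae cont])
qed

section \<open>Passivity and impedance energy preservation of the discretized model\<close>

theorem proposition3:
  fixes a b :: real
    and P G :: "real ^ ('n1::finite + 'n2::finite) ^ ('n1 + 'n2)"
    and H :: "real \<Rightarrow> real ^ ('n1 + 'n2) ^ ('n1 + 'n2)"
    and VB VC :: "real ^ (('n1 + 'n2) + ('n1 + 'n2)) ^ ('n1 + 'n2)"
    and \<phi>1 d\<phi>1 :: "real \<Rightarrow> real ^ 'N1::finite"
    and \<phi>2 d\<phi>2 :: "real \<Rightarrow> real ^ 'N2::finite"
    and E Q J R :: "real ^ (('n1 \<times> 'N1) + ('n2 \<times> 'N2)) ^ (('n1 \<times> 'N1) + ('n2 \<times> 'N2))"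
    and B :: "real ^ ('n1 + 'n2) ^ (('n1 \<times> 'N1) + ('n2 \<times> 'N2))"
  assumes "a < b"
    and "symmetric_mat P" and "invertible P"
    and "pos_semidef_mat (G + transpose G)"
    and "bounded (H ` {a..b})" and "C1_on_interval a b H"
    and "\<And>z. z \<in> {a..b} \<Longrightarrow> pos_def_mat (H z)"
    and "\<And>z. z \<in> {a..b} \<Longrightarrow> blk12 (H z) = 0 \<and> blk21 (H z) = 0"
    and "rank VB = CARD('n1 + 'n2)" and "rank VC = CARD('n1 + 'n2)"
    and "VB ** block_mat (matrix_inv P) 0 0 (- matrix_inv P) ** transpose VB = 0"
    and "VC ** block_mat (matrix_inv P) 0 0 (- matrix_inv P) ** transpose VC = 0"
    and "transpose VC ** VB + transpose VB ** VC = block_mat P 0 0 (- P)"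
    and "has_H1_derivative a b \<phi>1 d\<phi>1" and "has_H1_derivative a b \<phi>2 d\<phi>2"
    and "\<And>c. (\<forall>z\<in>{a..b}. (\<Sum>k\<in>UNIV. c k * \<phi>1 z $ k) = 0) \<Longrightarrow> (\<forall>k. c k = 0)"
    and "\<And>c. (\<forall>z\<in>{a..b}. (\<Sum>k\<in>UNIV. c k * \<phi>2 z $ k) = 0) \<Longrightarrow> (\<forall>k. c k = 0)"
    and "E = E_mat a b \<phi>1 \<phi>2"
    and "Q = Q_mat a b H \<phi>1 \<phi>2"
    and "J = J_mat a b P G VB VC \<phi>1 \<phi>2 d\<phi>1 d\<phi>2"
    and "R = R_mat a b G \<phi>1 \<phi>2"
    and "B = B_mat a b VC \<phi>1 \<phi>2"
  shows "passive_wrt (discrete_system E Q J R B) (discrete_energy Q)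
    \<and> (\<forall>x e. E *v e = Q *v x \<longrightarrow> 1/2 * (x \<bullet> (E *v e)) = discrete_energy Q x)
    \<and> (bcphs_IEP a b P G H VB VC \<longrightarrow> IEP_wrt (discrete_system E Q J R B) (discrete_energy Q))"
proof (intro conjI impI)
  have L2: "L2_fun a b \<phi>1" "L2_fun a b \<phi>2"
    using assms(14,15) unfolding has_H1_derivative_def by blast+
  have H: "continuous_on {a..b} H"
    using assms(6) has_vector_derivative_continuous
    unfolding C1_on_interval_def continuous_on_eq_continuous_within by blast
  have sym_H: "symmetric_mat (H z)" if "z \<in> {a..b}" for z
    using assms(7)[OF that] by (simp add: pos_def_mat_def)
  have H_nonneg: "0 \<le> v \<bullet> (H z *v v)" if "z \<in> {a..b}" for z v
    using assms(7)[OF that] by (cases "v = 0") (auto simp: pos_def_mat_def less_imp_le)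
  have Q: "Q = gram a b H \<phi>1 \<phi>2 \<phi>1 \<phi>2"
    unfolding assms(19) by (rule Q_mat_eq_gram[OF L2 H assms(8)])
  have E: "E = gram a b (\<lambda>_. mat 1) \<phi>1 \<phi>2 \<phi>1 \<phi>2"
    unfolding assms(18) by (rule E_mat_eq_gram[OF L2])
  have sym_Q: "v \<bullet> (Q *v w) = w \<bullet> (Q *v v)" for v w
    unfolding Q by (rule symmetric_gram[OF L2 H sym_H])
  have sym_E: "v \<bullet> (E *v w) = w \<bullet> (E *v v)" for v w
    unfolding E by (rule symmetric_gram[OF L2]) (auto simp: symmetric_mat_def transpose_mat)
  have inv_E: "invertible E"
    unfolding assms(18) by (rule invertible_injective) (rule E_mat_injective[OF assms(1,14-17)])
  have energy_nonneg: "0 \<le> discrete_energy Q z" for z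
    using gram_nonneg[OF L2 H H_nonneg, of z] unfolding discrete_energy_def Q by simp
  \<comment> \<open>The form of \<open>G\<close> is half the form of
    \<open>G + transpose G\<close>.\<close>
  have G_nonneg: "0 \<le> v \<bullet> (G *v v)" for v
  proof -
    have "0 \<le> v \<bullet> ((G + transpose G) *v v)"
      using assms(4) by (simp add: pos_semidef_mat_def)
    then show ?thesis
      unfolding matrix_vector_mult_add_rdistrib inner_add_right inner_transpose_mat by simp
  qed
  \<comment> \<open>The power dissipated by the ansatz function with coefficients
    \<open>v\<close>.\<close>
  define \<delta> where "\<delta> v = (LINT z|lebesgue_on {a..b}. trial v (\<phi>1 z) (\<phi>2 z) \<bullet> (G *v trial v (\<phi>1 z) (\<phi>2 z)))" for v
  have balance: "v \<bullet> ((J - R) *v v + B *v u) = u \<bullet> (transpose B *v v) - \<delta> v" for v u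
    unfolding \<delta>_def assms(20-22) by (rule discrete_power_balance[OF assms(1,2,13,14,15)])
  have \<delta>_nonneg: "0 \<le> \<delta> v" for v
    unfolding \<delta>_def by (simp add: G_nonneg)
  note power = discrete_system_power_balance[OF sym_Q sym_E inv_E balance]
  show "passive_wrt (discrete_system E Q J R B) (discrete_energy Q)"
    unfolding passive_wrt_def
  proof (intro conjI allI impI energy_nonneg)
    fix u x y assume sys: "discrete_system E Q J R B u x y"
    obtain e where ae: "AE t in lebesgue_on {0..}.
       ((\<lambda>s. discrete_energy Q (x s)) has_real_derivative u t \<bullet> y t - \<delta> (e t)) (at t within {0..})"
      and cont: "\<And>t. continuous_on {0..} u \<Longrightarrow> 0 \<le> t \<Longrightarrow>
       ((\<lambda>s. discrete_energy Q (x s)) has_real_derivative u t \<bullet> y t - \<delta> (e t)) (at t within {0..})"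
      using power[OF sys] by blast
    have le: "u t \<bullet> y t - \<delta> (e t) \<le> u t \<bullet> y t" for t
      using \<delta>_nonneg by simp
    show "AE t in lebesgue_on {0..}.
        \<exists>d. ((\<lambda>s. discrete_energy Q (x s)) has_real_derivative d) (at t within {0..}) \<and> d \<le> u t \<bullet> y t"
      using ae by eventually_elim (use le in blast)
    show "\<exists>d. ((\<lambda>s. discrete_energy Q (x s)) has_real_derivative d) (at t within {0..}) \<and> d \<le> u t \<bullet> y t"
      if "continuous_on {0..} u" "0 \<le> t" for t
      using cont[OF that] le by blast
  qed
  show "\<forall>x e. E *v e = Q *v x \<longrightarrow> 1/2 * (x \<bullet> (E *v e)) = discrete_energy Q x"
    by (simp add: discrete_energy_def)
  assume "bcphs_IEP a b P G H VB VC"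
  from bcphs_IEP_imp_lossless[OF assms(1-3) G_nonneg H assms(7,13) this]
  \<comment> \<open>The integrand vanishes pointwise, since the form of \<open>G\<close> is zero on
    all vectors.\<close>
  have \<delta>_0: "\<delta> v = 0" for v
    by (simp add: \<delta>_def)
  show "IEP_wrt (discrete_system E Q J R B) (discrete_energy Q)"
    unfolding IEP_wrt_def
  proof (intro conjI allI impI energy_nonneg)
    fix u x y assume sys: "discrete_system E Q J R B u x y"
    obtain e where ae: "AE t in lebesgue_on {0..}.
       ((\<lambda>s. discrete_energy Q (x s)) has_real_derivative u t \<bullet> y t - \<delta> (e t)) (at t within {0..})"
      and cont: "\<And>t. continuous_on {0..} u \<Longrightarrow> 0 \<le> t \<Longrightarrow>
       ((\<lambda>s. discrete_energy Q (x s)) has_real_derivative u t \<bullet> y t - \<delta> (e t)) (at t within {0..})"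
      using power[OF sys] by blast
    show "AE t in lebesgue_on {0..}.
        ((\<lambda>s. discrete_energy Q (x s)) has_real_derivative u t \<bullet> y t) (at t within {0..})"
      using ae by (simp add: \<delta>_0)
    show "((\<lambda>s. discrete_energy Q (x s)) has_real_derivative u t \<bullet> y t) (at t within {0..})"
      if "continuous_on {0..} u" "0 \<le> t" for t
      using cont[OF that] by (simp add: \<delta>_0)
  qed
qed

end
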